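(* In the (completed) free Novikov algebra $\mathcal N(x)$ on one generator $x=x_{(0)}$, the pre-Lie logarithm expands as $$\log_\triangleleft(x)=x+\sum_{n=2}^\infty\ \sum_{p\in\mathcal P_{n-1}}\left(\sum_{i=2}^{|p|+1}\frac{(-1)^{i-1}}{i}\,n_{p,i}\right)\frac{x_p}{p!},$$ and the coefficients $n_{p,k+1}$ ($p$ a nonempty partition, $k\ge1$) satisfy $$n_{p,k+1}=\sum_{(0)=p_0<_a p_1<_a\cdots<_a p_k=p}\ \prod_{h=1}^k C_{p_h,p_{h-1}},$$ the sum being over all sequences of partitions $p_0=(0),p_1,\dots,p_k=p$ in which each consecutive pair is admissible.
   Context: Let $\mathcal A=\mathbb{Q}[x_i:i\ge-1]$ with derivation $\partial(x_i)=x_{i+1}$, product $a\triangleleft b:=\partial(a)b$ and braces $a\{a_1\cdots a_n\}=a_1\cdots a_n\partial^n(a)$. $\mathcal N(x)\subset\mathcal A$, the span of monomials of weight $-1$ (weight = sum of indices), is the free (right) Novikov algebra on $x=x_{-1}$, graded by polynomial degree. $\mathcal P_n$ is the set of partitions of $n$; for $\mu=(\mu_1\ge\cdots\ge\mu_k\ge1)\in\mathcal P_n$ write $|\mu|=n$, $l(\mu)=k$, $\mu!=\prod\mu_i!$ and $x_\mu:=x_{\mu_1-1}\cdots x_{\mu_k-1}x_{-1}^{n-k+1}$. $\mathcal P_0=\{(0)\}$ contains only the empty partition (with $|(0)|=l((0))=0$, $(0)!=1$), and $x_{(0)}:=x_{-1}$. The $x_\mu$ form a basis of $\mathcal N(x)$;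 infinite sums live in the completion with respect to the degree. The pre-Lie logarithm $\log_\triangleleft$ is the compositional inverse of $\exp_\triangleleft(y)=\sum_{n\ge1}\frac1{n!}y^{\triangleleft n}$, $y^{\triangleleft n}=(\cdots(y\triangleleft y)\cdots)\triangleleft y$ ($n$ factors). The coefficient $n_{p,i+1}$ ($i\ge1$) is defined as the coefficient of $\frac{x_p}{p!}$ in the expansion of $$\sum_{k_1+\cdots+k_i=|p|,\ k_j\ge1}\frac{1}{k_1!\cdots k_i!}\big(\cdots(x\{x^{\odot k_1}\})\cdots\big)\{x^{\odot k_i}\},$$ where $y\{x^{\odot k}\}=x_{-1}^k\partial^k(y)$. For partitions $p',p$ with $|p|=|p'|+k$, $k\geq 1$, $C_{p,p'}$ is the coefficient of $\frac{k!}{p!}x_p$ in the expansion of $\frac{1}{p'!}x_{p'}\{x^{\odot k}\}$. Order on partitions: $\mu=(\mu_1,\dots,\mu_k)<\nu=(\nu_1,\dots,\nu_l)$ iff $k\le l$, $\mu_i\le\nu_i$ for all $i\le k$, and at least one of these inequalities is strict. The pair is admissible, written $p'<_a p$, iff $p'<p$ and $l(p)\le|p'|+1$. *)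

theory Defs
  imports "HOL-Library.Poly_Mapping" "HOL-Computational_Algebra.Formal_Power_Series"
begin

section \<open>The differential polynomial algebra \<open>\<A> = \<rat>[x\<^sub>i : i \<ge> -1]\<close>\<close>

text \<open>
  The variable \<open>x\<^sub>i\<close> (\<open>i \<ge> -1\<close>) is encoded by the index \<open>i + 1 :: nat\<close>; a monomial is its
  exponent function.  Thus \<open>xv j\<close> is \<open>x\<^sub>j\<^sub>-\<^sub>1\<close>, and the generator \<open>x = x\<^sub>-\<^sub>1\<close> is \<open>xv 0\<close>.
\<close>

type_synonym monom = "nat \<Rightarrow>\<^sub>0 nat"
type_synonym alg = "monom \<Rightarrow>\<^sub>0 rat"

definition const :: "rat \<Rightarrow> alg" where
  "const c = Poly_Mapping.single 0 c"

definition xmonom :: "monom \<Rightarrow> alg" where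
  "xmonom m = Poly_Mapping.single m 1"

definition xv :: "nat \<Rightarrow> alg" where
  "xv j = xmonom (Poly_Mapping.single j 1)"

abbreviation gen :: alg where
  "gen \<equiv> xv 0"

text \<open>
  The derivation is given by the explicit formula on monomials; \<open>der_add\<close>, \<open>der_const\<close>,
  \<open>der_xv\<close> and \<open>der_mult\<close> below characterise it as the derivation with \<open>\<partial>(x\<^sub>i) = x\<^sub>i\<^sub>+\<^sub>1\<close>.
\<close>

definition der_monom :: "monom \<Rightarrow> alg" where
  "der_monom m = (\<Sum>j\<in>Poly_Mapping.keys m.
     const (of_nat (Poly_Mapping.lookup m j)) * xv (Suc j) * xmonom (m - Poly_Mapping.single j 1))"

definition der :: "alg \<Rightarrow> alg" where
  "der f = (\<Sum>m\<in>Poly_Mapping.keys f. const (Poly_Mapping.lookup f m) * der_monom m)"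

definition nov_prod :: "alg \<Rightarrow> alg \<Rightarrow> alg" (infixl \<open>\<triangleleft>\<close> 70) where
  "a \<triangleleft> b = der a * b"

text \<open>\<open>brace a [a\<^sub>1, \<dots>, a\<^sub>n]\<close> is \<open>a{a\<^sub>1 \<cdots> a\<^sub>n}\<close>.\<close>

definition brace :: "alg \<Rightarrow> alg list \<Rightarrow> alg" where
  "brace a as = prod_list as * (der ^^ length as) a"

section \<open>The free Novikov algebra on one generator and its completion\<close>

definition mdeg :: "monom \<Rightarrow> nat" where
  "mdeg m = (\<Sum>j\<in>Poly_Mapping.keys m. Poly_Mapping.lookup m j)"

definition mweight :: "monom \<Rightarrow> int" where
  "mweight m = (\<Sum>j\<in>Poly_Mapping.keys m. (int j - 1) * int (Poly_Mapping.lookup m j))"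

definition Nov :: "alg set" where
  "Nov = {f. \<forall>m\<in>Poly_Mapping.keys f. mweight m = -1}"

definition homogeneous :: "nat \<Rightarrow> alg \<Rightarrow> bool" where
  "homogeneous n f \<longleftrightarrow> (\<forall>m\<in>Poly_Mapping.keys f. mdeg m = n)"

text \<open>
  The completion of \<open>\<N>(x)\<close> with respect to the degree is the product of its homogeneous components.
  A family \<open>(f\<^sub>n)\<close> of components is stored as the formal power series \<open>\<Sum>n. f\<^sub>n t\<^sup>n\<close>, so that
  the metric topology on \<^typ>\<open>alg fps\<close>, and with it \<^const>\<open>summable\<close> and \<^const>\<open>suminf\<close>, is
  that of the degree filtration.
\<close>

definition Nov_compl :: "alg fps set" where
  "Nov_compl = {F. \<forall>n. fps_nth F n \<in> Nov \<and> homogeneous n (fps_nth F n)}"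

definition hom_part :: "nat \<Rightarrow> alg \<Rightarrow> alg" where
  "hom_part n f = (\<Sum>m | m \<in> Poly_Mapping.keys f \<and> mdeg m = n.
     Poly_Mapping.single m (Poly_Mapping.lookup f m))"

definition embed :: "alg \<Rightarrow> alg fps" where
  "embed f = Abs_fps (\<lambda>n. hom_part n f)"

text \<open>The extension of \<open>\<triangleleft>\<close> and of rational scalars to the completion.\<close>

definition cprod :: "alg fps \<Rightarrow> alg fps \<Rightarrow> alg fps" (infixl \<open>\<triangleleft>\<^sub>c\<close> 70) where
  "F \<triangleleft>\<^sub>c G = Abs_fps (\<lambda>n. \<Sum>i\<le>n. fps_nth F i \<triangleleft> fps_nth G (n - i))"

definition cscale :: "rat \<Rightarrow> alg fps \<Rightarrow> alg fps" where
  "cscale q F = Abs_fps (\<lambda>n. const q * fps_nth F n)"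

section \<open>Pre-Lie exponential and logarithm\<close>

text \<open>\<open>prelie_pow Y n\<close> is the left-nested power with \<open>n + 1\<close> factors.\<close>

primrec prelie_pow :: "alg fps \<Rightarrow> nat \<Rightarrow> alg fps" where
  "prelie_pow Y 0 = Y"
| "prelie_pow Y (Suc n) = prelie_pow Y n \<triangleleft>\<^sub>c Y"

definition prelie_exp :: "alg fps \<Rightarrow> alg fps" where
  "prelie_exp Y = suminf (\<lambda>n. cscale (1 / fact (Suc n)) (prelie_pow Y n))"

definition prelie_log :: "alg fps \<Rightarrow> alg fps" where
  "prelie_log = inv_into Nov_compl prelie_exp"

section \<open>Partitions\<close>

text \<open>Partitions are weakly decreasing lists of positive parts; \<open>(0)\<close> is the empty list.\<close>

definition is_partition :: "nat list \<Rightarrow> bool" where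
  "is_partition p \<longleftrightarrow> sorted_wrt (\<ge>) p \<and> (\<forall>i\<in>set p. 1 \<le> i)"

definition partitions :: "nat \<Rightarrow> nat list set" where
  "partitions n = {p. is_partition p \<and> sum_list p = n}"

definition pfact :: "nat list \<Rightarrow> rat" where
  "pfact p = prod_list (map fact p)"

definition part_less :: "nat list \<Rightarrow> nat list \<Rightarrow> bool" where
  "part_less p q \<longleftrightarrow> length p \<le> length q \<and> (\<forall>i<length p. p ! i \<le> q ! i) \<and>
     (length p < length q \<or> (\<exists>i<length p. p ! i < q ! i))"

definition admissible :: "nat list \<Rightarrow> nat list \<Rightarrow> bool" where
  "admissible p' p \<longleftrightarrow> part_less p' p \<and> length p \<le> sum_list p' + 1"

text \<open>The factor \<open>x\<^bsub>\<mu>\<^sub>i - 1\<^esub>\<close> is \<open>xv \<mu>\<^sub>i\<close> because of the index shift.\<close>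

definition xpart :: "nat list \<Rightarrow> alg" where
  "xpart p = prod_list (map xv p) * gen ^ (sum_list p - length p + 1)"

text \<open>
  The \<open>x\<^sub>p\<close> are pairwise distinct monomials, so the coefficient of \<open>x\<^sub>p\<close> in an
  expansion is the coefficient of its exponent vector \<open>xpart_exp p\<close> (see \<open>xpart_eq_monom\<close>).
  \<open>coeff_scaled s p f\<close> is the coefficient of \<open>s x\<^sub>p\<close> (\<open>s \<noteq> 0\<close>) in \<open>f\<close>.
\<close>

definition xpart_exp :: "nat list \<Rightarrow> monom" where
  "xpart_exp p = (\<Sum>j\<leftarrow>p. Poly_Mapping.single j 1)
     + Poly_Mapping.single 0 (sum_list p - length p + 1)"

definition coeff_scaled :: "rat \<Rightarrow> nat list \<Rightarrow> alg \<Rightarrow> rat" where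
  "coeff_scaled s p f = Poly_Mapping.lookup f (xpart_exp p) / s"

section \<open>The coefficients\<close>

definition compositions :: "nat \<Rightarrow> nat \<Rightarrow> nat list set" where
  "compositions i n = {ks. length ks = i \<and> (\<forall>k\<in>set ks. 1 \<le> k) \<and> sum_list ks = n}"

definition iter_brace :: "nat list \<Rightarrow> alg" where
  "iter_brace ks = foldl (\<lambda>y k. brace y (replicate k gen)) gen ks"

text \<open>\<open>ncoef p j\<close> is \<open>n\<^bsub>p,j\<^esub>\<close>, meaningful for \<open>j \<ge> 2\<close>; the sum then involves \<open>j - 1\<close> braces.\<close>

definition ncoef :: "nat list \<Rightarrow> nat \<Rightarrow> rat" where
  "ncoef p j = coeff_scaled (1 / pfact p) p
     (\<Sum>ks\<in>compositions (j - 1) (sum_list p).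
        const (1 / prod_list (map fact ks)) * iter_brace ks)"

text \<open>\<open>Ccoef p p'\<close> is \<open>C\<^bsub>p,p'\<^esub>\<close>, meaningful for \<open>\<bar>p'\<bar> < \<bar>p\<bar>\<close>.\<close>

definition Ccoef :: "nat list \<Rightarrow> nat list \<Rightarrow> rat" where
  "Ccoef p p' = (let k = sum_list p - sum_list p' in
     coeff_scaled (fact k / pfact p) p
       (const (1 / pfact p') * brace (xpart p') (replicate k gen)))"

definition adm_chains :: "nat \<Rightarrow> nat list \<Rightarrow> nat list list set" where
  "adm_chains k p = {ps. length ps = k + 1 \<and> (\<forall>h\<le>k. is_partition (ps ! h)) \<and>
     ps ! 0 = [] \<and> ps ! k = p \<and> (\<forall>h\<in>{1..k}. admissible (ps ! (h - 1)) (ps ! h))}"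

text \<open>The term of degree \<open>n\<close> in the expansion of the logarithm.\<close>

definition log_term :: "nat \<Rightarrow> alg" where
  "log_term n = (\<Sum>p\<in>partitions (n - 1).
     const ((\<Sum>i=2..sum_list p + 1. (-1) ^ (i - 1) / of_nat i * ncoef p i) / pfact p) * xpart p)"

section \<open>Consistency of the definitions\<close>

lemma const_0 [simp]: "const 0 = 0"
  by (simp add: const_def)

lemma const_add: "const (a + b) = const a + const b"
  by (simp add: const_def single_add)

lemma const_mult: "const (a * b) = const a * const b"
  by (simp add: const_def mult_single)

lemma xmonom_add: "xmonom (m + n) = xmonom m * xmonom n"
  by (simp add: xmonom_def mult_single)

lemma der_superset:
  assumes "finite S" "Poly_Mapping.keys f \<subseteq> S"
  shows "der f = (\<Sum>m\<in>S. const (Poly_Mapping.lookup f m) * der_monom m)"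
  unfolding der_def using assms
  by (intro sum.mono_neutral_left) (auto simp: in_keys_iff)

lemma der_0 [simp]: "der 0 = 0"
  by (simp add: der_def)

lemma der_add: "der (f + g) = der f + der g"
proof -
  let ?S = "Poly_Mapping.keys f \<union> Poly_Mapping.keys g"
  have "der h = (\<Sum>m\<in>?S. const (Poly_Mapping.lookup h m) * der_monom m)" if "h \<in> {f, g, f + g}" for h
    using that Poly_Mapping.keys_add[of f g] by (intro der_superset) auto
  then show ?thesis
    by (simp add: lookup_add const_add distrib_right sum.distrib)
qed

lemma der_single: "der (Poly_Mapping.single m c) = const c * der_monom m"
  by (cases "c = 0") (simp_all add: der_def)

lemma der_const: "der (const c) = 0"
  unfolding const_def der_single by (simp add: der_monom_def)

lemma der_xv: "der (xv j) = xv (Suc j)"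
  unfolding xv_def xmonom_def der_single
  by (simp add: der_monom_def const_def xv_def xmonom_def mult_single)

lemma der_monom_superset:
  assumes "finite S" "Poly_Mapping.keys m \<subseteq> S"
  shows "der_monom m = (\<Sum>j\<in>S. const (of_nat (Poly_Mapping.lookup m j)) * xv (Suc j)
           * xmonom (m - Poly_Mapping.single j 1))"
  unfolding der_monom_def using assms
  by (intro sum.mono_neutral_left) (auto simp: in_keys_iff)

lemma der_monom_add:
  "der_monom (m + n) = der_monom m * xmonom n + xmonom m * der_monom n"
proof -
  let ?S = "Poly_Mapping.keys m \<union> Poly_Mapping.keys n"
  let ?t = "\<lambda>m j. const (of_nat (Poly_Mapping.lookup m j)) * xv (Suc j)
           * xmonom (m - Poly_Mapping.single j 1)"
  have S: "der_monom h = (\<Sum>j\<in>?S. ?t h j)" if "h \<in> {m, n, m + n}" for h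
    using that Poly_Mapping.keys_add[of m n] by (intro der_monom_superset) auto
  have shift: "const (of_nat (Poly_Mapping.lookup a j)) * xmonom (a + b - Poly_Mapping.single j 1)
      = const (of_nat (Poly_Mapping.lookup a j)) * (xmonom (a - Poly_Mapping.single j 1) * xmonom b)"
    for a b :: monom and j
  proof (cases "Poly_Mapping.lookup a j = 0")
    case False
    then have "a + b - Poly_Mapping.single j 1 = (a - Poly_Mapping.single j 1) + b"
      by (intro poly_mapping_eqI) (auto simp: lookup_add lookup_minus lookup_single when_def)
    then show ?thesis by (simp add: xmonom_add)
  qed simp
  have "?t (m + n) j = ?t m j * xmonom n + xmonom m * ?t n j" for j
  proof -
    let ?e = "Poly_Mapping.single j (1 :: nat)"
    let ?c = "\<lambda>a. const (of_nat (Poly_Mapping.lookup a j))"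
    have "?t (m + n) j = xv (Suc j) * (?c m * xmonom (m + n - ?e))
        + xv (Suc j) * (?c n * xmonom (n + m - ?e))"
      by (simp only: lookup_add of_nat_add const_add distrib_right add.commute[of n m] mult.assoc
            mult.left_commute)
    also have "\<dots> = ?t m j * xmonom n + xmonom m * ?t n j"
      unfolding shift by (simp only: mult_ac)
    finally show ?thesis .
  qed
  then show ?thesis
    by (simp add: S sum.distrib sum_distrib_left sum_distrib_right)
qed

lemma alg_induct [case_names zero single add]:
  assumes "P 0" "\<And>m c. P (Poly_Mapping.single m c)" "\<And>f g. P f \<Longrightarrow> P g \<Longrightarrow> P (f + g)"
  shows "P (f :: alg)"
proof -
  have "P (\<Sum>m\<in>S. Poly_Mapping.single m (Poly_Mapping.lookup f m))" if "finite S" for S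
    using that by induction (simp_all add: assms)
  moreover have "f = (\<Sum>m\<in>Poly_Mapping.keys f. Poly_Mapping.single m (Poly_Mapping.lookup f m))"
    by (rule poly_mapping_eqI)
      (auto simp: lookup_sum lookup_single when_def sum.delta' in_keys_iff)
  ultimately show ?thesis by (metis finite_keys)
qed

lemma single_eq: "Poly_Mapping.single m c = const c * xmonom m"
  by (simp add: const_def xmonom_def mult_single)

lemma der_mult: "der (f * g) = der f * g + f * der g"
proof (induction f rule: alg_induct)
  case (single m c)
  show ?case
  proof (induction g rule: alg_induct)
    case (single n d)
    have "der (Poly_Mapping.single m c * Poly_Mapping.single n d)
        = const c * const d * (der_monom m * xmonom n + xmonom m * der_monom n)"
      by (simp only: mult_single der_single der_monom_add const_mult)
    then show ?case
      unfolding der_single unfolding single_eq by (simp only: distrib_left mult_ac)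
  qed (simp_all add: der_add distrib_left)
qed (simp_all add: der_add distrib_right)

lemma xpart_eq_monom: "xpart p = xmonom (xpart_exp p)"
proof -
  have "prod_list (map xv p) = xmonom (\<Sum>j\<leftarrow>p. Poly_Mapping.single j 1)" for p
    by (induction p) (simp_all add: xv_def xmonom_add, simp add: xmonom_def)
  moreover have "gen ^ n = xmonom (Poly_Mapping.single 0 n)" for n
  proof (induction n)
    case (Suc n)
    have "Poly_Mapping.single 0 (Suc n) = Poly_Mapping.single 0 1 + Poly_Mapping.single (0::nat) n"
      by (simp flip: single_add)
    then show ?case using Suc by (simp add: xmonom_add xv_def)
  qed (simp add: xmonom_def)
  ultimately show ?thesis
    unfolding xpart_def xpart_exp_def xmonom_add by (simp only:)
qed

lemma prelie_pow_nth_eq_0: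
  assumes "fps_nth Y 0 = 0" "k \<le> n"
  shows "fps_nth (prelie_pow Y n) k = 0"
  using assms(2)
proof (induction n arbitrary: k)
  case (Suc n)
  have "fps_nth (prelie_pow Y n) i \<triangleleft> fps_nth Y (k - i) = 0" if "i \<le> k" for i
    using Suc that assms(1) by (cases "i = k"; cases "i \<le> n") (auto simp: nov_prod_def)
  then show ?case by (simp add: cprod_def)
qed (use assms in simp)

lemma Nov_compl_nth_0: "Y \<in> Nov_compl \<Longrightarrow> fps_nth Y 0 = 0"
proof -
  assume "Y \<in> Nov_compl"
  then have w: "mweight m = -1" "mdeg m = 0" if "m \<in> Poly_Mapping.keys (fps_nth Y 0)" for m
    using that by (auto simp: Nov_compl_def Nov_def homogeneous_def)
  have "mweight m = 0" if "mdeg m = 0" for m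
    using that by (auto simp: mweight_def mdeg_def)
  then have "Poly_Mapping.keys (fps_nth Y 0) = {}" using w by force
  then show ?thesis by simp
qed

lemma summable_prelie_exp:
  assumes "Y \<in> Nov_compl"
  shows "summable (\<lambda>n. cscale (1 / fact (Suc n)) (prelie_pow Y n))"
proof -
  let ?a = "\<lambda>n. cscale (1 / fact (Suc n)) (prelie_pow Y n)"
  have z: "fps_nth (?a n) k = 0" if "k \<le> n" for n k
    using prelie_pow_nth_eq_0[OF Nov_compl_nth_0[OF assms] that] by (simp add: cscale_def)
  have "?a sums Abs_fps (\<lambda>k. \<Sum>n<k. fps_nth (?a n) k)"
    unfolding sums_def
  proof (rule tendsto_fpsI)
    fix k
    have "(\<Sum>n<N. fps_nth (?a n) k) = (\<Sum>n<k. fps_nth (?a n) k)" if "N \<ge> k" for N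
      using that z by (intro sum.mono_neutral_right) auto
    then show "\<forall>\<^sub>F N in sequentially. fps_nth (\<Sum>n<N. ?a n) k
        = fps_nth (Abs_fps (\<lambda>k. \<Sum>n<k. fps_nth (?a n) k)) k"
      unfolding eventually_at_top_linorder fps_sum_nth fps_nth_Abs_fps by blast
  qed
  then show ?thesis by (rule sums_summable)
qed

end

theory Submission
  imports Defs "HOL-Computational_Algebra.Polynomial" "HOL-Library.Multiset"
begin

text \<open>
  Reading \<open>\<partial>\<close> as \<open>d/dt\<close>, the operator \<open>T = \<Sum>\<^sub>k x\<^sup>k \<partial>\<^sup>k / k!\<close> is substitution along
  \<open>t \<mapsto> t + x(t)\<close>, and its \<open>n\<close>-th iterate is substitution along \<open>t \<mapsto> t + h\<^sub>n(t)\<close> with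
  \<open>h\<^sub>n = \<Sum>\<^sub>i (n choose i+1) E\<^sup>i x\<close>, where \<open>E = T - 1\<close>.  Each homogeneous component of \<open>h\<^sub>n\<close> is a
  polynomial in \<open>n\<close>; its linear term \<open>L = \<Sum>\<^sub>i (-1)\<^sup>i E\<^sup>i x / (i+1)\<close> is the claimed logarithm, since
  \<open>E\<^sup>i x\<close> collects the iterated braces.  Comparing linear terms in
  \<open>h\<^bsub>n+m\<^esub> = h\<^sub>n + T\<^sup>n h\<^sub>m\<close> gives the differential equation \<open>h' = L + L \<partial>h\<close> in the time
  variable, whose solution is \<open>h\<^sub>s = \<Sum>\<^sub>n s\<^sup>n L\<^bsup>\<triangleleft>n\<^esup> / n!\<close>; at \<open>s = 1\<close> this says
  \<open>exp\<^sub>\<triangleleft> L = x\<close>.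

  For the coefficients, \<open>\<partial>\<close> raises one index of a monomial, so the number of factors with index at
  least \<open>j\<close> never decreases; this forces \<open>p' <\<^sub>a p\<close> whenever \<open>C\<^bsub>p,p'\<^esub> \<noteq> 0\<close>, and peeling off the
  last brace gives a recursion for \<open>n\<^bsub>p,k+1\<^esub>\<close> that unfolds to the sum over chains.
\<close>

section \<open>Differential substitution in the completed algebra\<close>

lemma const_1 [simp]: "const 1 = 1"
  by (simp add: const_def)

lemma const_of_nat: "const (of_nat n) = of_nat n"
  by (induction n) (simp_all add: const_add)

lemma const_uminus: "const (- a) = - const a"
  by (simp add: const_def single_uminus)

lemma der_sum: "der (\<Sum>i\<in>A. f i) = (\<Sum>i\<in>A. der (f i))"
  by (induction A rule: infinite_finite_induct) (simp_all add: der_add)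

lemma der_const_mult: "der (const c * f) = const c * der f"
  by (simp add: der_mult der_const)

section \<open>Derivation, rational scalars and divided powers on the completion\<close>

definition cder :: "alg fps \<Rightarrow> alg fps" where
  "cder F = Abs_fps (\<lambda>n. der (fps_nth F n))"

lemma cder_nth [simp]: "fps_nth (cder F) n = der (fps_nth F n)"
  by (simp add: cder_def)

lemma cder_0 [simp]: "cder 0 = 0"
  by (rule fps_ext) simp

lemma cder_add: "cder (F + G) = cder F + cder G"
  by (rule fps_ext) (simp add: der_add)

lemma cder_mult: "cder (F * G) = cder F * G + F * cder G"
  by (rule fps_ext) (simp add: fps_mult_nth der_sum der_mult sum.distrib)

lemma cprod_eq: "F \<triangleleft>\<^sub>c G = cder F * G"
  by (rule fps_ext) (simp add: cprod_def nov_prod_def fps_mult_nth atMost_atLeast0)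

definition scal :: "rat \<Rightarrow> alg fps" where
  "scal q = fps_const (const q)"

lemma scal_mult: "scal (a * b) = scal a * scal b"
  by (simp add: scal_def const_mult)

lemma scal_add: "scal (a + b) = scal a + scal b"
  by (simp add: scal_def const_add)

lemma scal_0 [simp]: "scal 0 = 0" and scal_1 [simp]: "scal 1 = 1"
  by (simp_all add: scal_def)

lemma scal_of_nat: "scal (of_nat n) = of_nat n"
  by (induction n) (simp_all add: scal_add)

lemma scal_nth_mult [simp]: "fps_nth (scal q * F) n = const q * fps_nth F n"
  by (simp add: scal_def)

lemma cder_scal: "cder (scal q * F) = scal q * cder F"
  by (rule fps_ext) (simp add: der_const_mult)

text \<open>The divided power \<open>\<partial>^k / k!\<close>, with which the Leibniz rule carries
  no binomial coefficients.\<close>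

definition ddiv :: "nat \<Rightarrow> alg fps \<Rightarrow> alg fps" where
  "ddiv k F = scal (1 / fact k) * (cder ^^ k) F"

lemma cder_funpow_0: "(cder ^^ k) 0 = 0"
  by (induction k) simp_all

lemma cder_funpow_add: "(cder ^^ k) (F + G) = (cder ^^ k) F + (cder ^^ k) G"
  by (induction k) (simp_all add: cder_add)

lemma cder_funpow_scal: "(cder ^^ k) (scal q * F) = scal q * (cder ^^ k) F"
  by (induction k) (simp_all add: cder_scal)

lemma cder_funpow_nth: "fps_nth ((cder ^^ k) F) n = (der ^^ k) (fps_nth F n)"
  by (induction k) simp_all

lemma ddiv_0 [simp]: "ddiv 0 F = F"
  by (simp add: ddiv_def)

lemma ddiv_1 [simp]: "ddiv (Suc 0) F = cder F"
  by (simp add: ddiv_def)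

lemma ddiv_of_0 [simp]: "ddiv k 0 = 0"
  by (simp add: ddiv_def cder_funpow_0)

lemma ddiv_add: "ddiv k (F + G) = ddiv k F + ddiv k G"
  by (simp add: ddiv_def cder_funpow_add distrib_left)

lemma ddiv_nth_0: "fps_nth F n = 0 \<Longrightarrow> fps_nth (ddiv k F) n = 0"
  using cder_funpow_nth[of k F n] cder_funpow_nth[of k 0 n] by (simp add: ddiv_def cder_funpow_0)

lemma ddiv_nth_cong: "fps_nth F n = fps_nth G n \<Longrightarrow> fps_nth (ddiv k F) n = fps_nth (ddiv k G) n"
  by (simp add: ddiv_def cder_funpow_nth)

lemma ddiv_Suc: "scal (of_nat (Suc n)) * ddiv (Suc n) F = cder (ddiv n F)"
  unfolding ddiv_def cder_scal mult.assoc[symmetric] scal_mult[symmetric] by simp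

lemma ddiv_ddiv: "ddiv j (ddiv k F) = scal (of_nat ((j + k) choose j)) * ddiv (j + k) F"
proof -
  have "1 / fact j * (1 / fact k) = of_nat ((j + k) choose j) * (1 / fact (j + k) :: rat)"
    by (simp add: binomial_fact[of j "j + k"])
  then show ?thesis
    by (simp add: ddiv_def cder_funpow_scal funpow_add flip: mult.assoc scal_mult)
qed

lemma scal_cancel: "q \<noteq> 0 \<Longrightarrow> scal q * F = scal q * G \<Longrightarrow> F = G"
proof -
  assume q: "q \<noteq> 0" and eq: "scal q * F = scal q * G"
  have "H = scal (1 / q) * (scal q * H)" for H
    using q by (simp flip: mult.assoc scal_mult)
  then show "F = G" using eq by metis
qed

lemma cder_sum: "cder (\<Sum>i\<in>A. f i) = (\<Sum>i\<in>A. cder (f i))"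
  by (induction A rule: infinite_finite_induct) (simp_all add: cder_add)

text \<open>Leibniz rule, by induction after multiplying by \<open>n + 1\<close>: in
  \<open>n + 1 = k + (n + 1 - k)\<close> each summand is absorbed into one of the two factors by
  \<open>ddiv_Suc\<close>.\<close>

lemma ddiv_mult: "ddiv n (F * G) = (\<Sum>k\<le>n. ddiv k F * ddiv (n - k) G)"
proof (induction n)
  case (Suc n)
  let ?s = "\<lambda>n. scal (of_nat n)"
  have a: "(\<Sum>k\<le>Suc n. (?s k * ddiv k F) * ddiv (Suc n - k) G)
      = (\<Sum>k\<le>n. cder (ddiv k F) * ddiv (n - k) G)"
    unfolding sum.atMost_Suc_shift ddiv_Suc by simp
  have b: "(\<Sum>k\<le>Suc n. ddiv k F * (?s (Suc n - k) * ddiv (Suc n - k) G))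
      = (\<Sum>k\<le>n. ddiv k F * cder (ddiv (n - k) G))"
  proof -
    have "?s (Suc n - k) * ddiv (Suc n - k) G = cder (ddiv (n - k) G)" if "k \<le> n" for k
      using ddiv_Suc[of "n - k" G] that by (simp only: Suc_diff_le)
    then have "(\<Sum>k\<le>n. ddiv k F * (?s (Suc n - k) * ddiv (Suc n - k) G))
        = (\<Sum>k\<le>n. ddiv k F * cder (ddiv (n - k) G))"
      by (intro sum.cong refl) (simp only: atMost_iff)
    then show ?thesis by (simp only: sum.atMost_Suc) simp
  qed
  have "?s (Suc n) * (\<Sum>k\<le>Suc n. ddiv k F * ddiv (Suc n - k) G)
      = (\<Sum>k\<le>Suc n. (?s k + ?s (Suc n - k)) * (ddiv k F * ddiv (Suc n - k) G))"
    unfolding sum_distrib_left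
    by (intro sum.cong refl) (simp flip: scal_add of_nat_add del: of_nat_Suc)
  also have "\<dots> = (\<Sum>k\<le>Suc n. (?s k * ddiv k F) * ddiv (Suc n - k) G)
      + (\<Sum>k\<le>Suc n. ddiv k F * (?s (Suc n - k) * ddiv (Suc n - k) G))"
  proof -
    have "(a + b) * (x * y) = (a * x) * y + x * (b * y)" for a b x y :: "alg fps"
      by (simp only: distrib_right mult.assoc mult.left_commute[of x b y])
    then show ?thesis by (simp only: sum.distrib)
  qed
  also have "\<dots> = cder (\<Sum>k\<le>n. ddiv k F * ddiv (n - k) G)"
    unfolding a b by (simp add: cder_sum cder_mult sum.distrib)
  also have "\<dots> = ?s (Suc n) * ddiv (Suc n) (F * G)"
    unfolding ddiv_Suc Suc ..
  finally show ?case
    using scal_cancel[OF of_nat_neq_0[of n]] by (simp only:)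
qed simp

section \<open>Substitution operators and their composition\<close>

lemma fps_nth_mult_cong:
  assumes "\<And>n. n \<le> N \<Longrightarrow> fps_nth F n = fps_nth F' n" "\<And>n. n \<le> N \<Longrightarrow> fps_nth G n = fps_nth G' n"
  shows "fps_nth (F * G) N = fps_nth (F' * G') N"
  using assms by (simp add: fps_mult_nth)

text \<open>Substitution \<open>t \<mapsto> t + h(t)\<close> when \<open>F\<close> is read as a function of \<open>t\<close> and \<open>\<partial>\<close> as
  \<open>d/dt\<close>.\<close>

definition tshift :: "alg fps \<Rightarrow> alg fps \<Rightarrow> alg fps" where
  "tshift h F = Abs_fps (\<lambda>d. \<Sum>k\<le>d. fps_nth (h ^ k * ddiv k F) d)"

lemma power_mult_nth_eq_0:
  fixes h F :: "alg fps"
  assumes "fps_nth h 0 = 0" "d < k"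
  shows "fps_nth (h ^ k * F) d = 0"
  using startsby_zero_power_prefix[OF assms(1), of k] assms(2) by (simp add: fps_mult_nth)

text \<open>Since \<open>h ^ k\<close> starts in degree \<open>k\<close>, the cut-off at
  \<open>d\<close> may be raised to any common bound, so that products can be compared through
  finite sums.\<close>

lemma tshift_nth:
  assumes "fps_nth h 0 = 0" "d \<le> M"
  shows "fps_nth (tshift h F) d = fps_nth (\<Sum>k\<le>M. h ^ k * ddiv k F) d"
  unfolding tshift_def fps_nth_Abs_fps fps_sum_nth
  using assms by (intro sum.mono_neutral_left) (auto simp: power_mult_nth_eq_0)

lemma tshift_add: "tshift h (F + G) = tshift h F + tshift h G"
  by (rule fps_ext) (simp add: tshift_def ddiv_add distrib_left sum.distrib)

lemma tshift_of_0 [simp]: "tshift h 0 = 0"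
  by (rule fps_ext) (simp add: tshift_def)

lemma tshift_sum: "tshift h (\<Sum>i\<in>A. f i) = (\<Sum>i\<in>A. tshift h (f i))"
  by (induction A rule: infinite_finite_induct) (simp_all add: tshift_add)

lemma tshift_0 [simp]: "tshift 0 F = F"
proof (rule fps_ext)
  fix d
  have "(\<Sum>k\<le>d. fps_nth (0 ^ k * ddiv k F) d) = (\<Sum>k\<in>{0}. fps_nth (0 ^ k * ddiv k F) d)"
    by (intro sum.mono_neutral_right) (auto simp: power_0_left split: if_splits)
  then show "fps_nth (tshift 0 F) d = fps_nth F d" by (simp add: tshift_def)
qed

lemma tshift_nth_0: "fps_nth (tshift h F) 0 = fps_nth F 0"
  by (simp add: tshift_def)

lemma tshift_nth_cong:
  assumes "\<And>n. n \<le> N \<Longrightarrow> fps_nth F n = fps_nth G n"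
  shows "fps_nth (tshift h F) N = fps_nth (tshift h G) N"
  unfolding tshift_def fps_nth_Abs_fps
  by (intro sum.cong refl fps_nth_mult_cong ddiv_nth_cong) (auto simp: assms)

lemma sum_square_triangle:
  fixes f :: "nat \<Rightarrow> nat \<Rightarrow> 'a :: comm_monoid_add"
  assumes "\<And>j k. j + k > N \<Longrightarrow> f j k = 0"
  shows "(\<Sum>j\<le>N. \<Sum>k\<le>N. f j k) = (\<Sum>n\<le>N. \<Sum>j\<le>n. f j (n - j))"
proof -
  have "(\<Sum>j\<le>N. \<Sum>k\<le>N. f j k) = (\<Sum>(j, k)\<in>{..N} \<times> {..N}. f j k)"
    by (simp add: sum.cartesian_product)
  also have "\<dots> = (\<Sum>(j, k)\<in>{(j, k). j + k \<le> N}. f j k)"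
    using assms by (intro sum.mono_neutral_right) (auto intro: leI)
  also have "\<dots> = (\<Sum>n\<le>N. \<Sum>j\<le>n. f j (n - j))"
    by (rule sum.triangle_reindex_eq)
  finally show ?thesis .
qed

text \<open>Leibniz rule summed over all orders: terms with \<open>j + k > N\<close> vanish in
  degree \<open>N\<close>, so the square of indices shrinks to a triangle, grouped by
  \<open>n = j + k\<close>.\<close>

lemma tshift_mult:
  assumes h: "fps_nth h 0 = 0"
  shows "tshift h (F * G) = tshift h F * tshift h G"
proof (rule fps_ext)
  fix N
  let ?f = "\<lambda>j k. fps_nth (h ^ (j + k) * (ddiv j F * ddiv k G)) N"
  have "fps_nth (tshift h F * tshift h G) N
      = fps_nth ((\<Sum>k\<le>N. h ^ k * ddiv k F) * (\<Sum>k\<le>N. h ^ k * ddiv k G)) N"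
    using h by (intro fps_nth_mult_cong) (simp_all only: tshift_nth[of h _ N])
  also have "\<dots> = (\<Sum>j\<le>N. \<Sum>k\<le>N. ?f j k)"
    by (simp add: sum_product fps_sum_nth power_add mult_ac)
  also have "\<dots> = (\<Sum>n\<le>N. \<Sum>j\<le>n. ?f j (n - j))"
    using h by (intro sum_square_triangle power_mult_nth_eq_0)
  also have "\<dots> = fps_nth (tshift h (F * G)) N"
    by (simp add: tshift_def ddiv_mult sum_distrib_left fps_sum_nth)
  finally show "fps_nth (tshift h (F * G)) N = fps_nth (tshift h F * tshift h G) N" ..
qed

lemma tshift_1 [simp]: "tshift h 1 = 1"
proof (rule fps_ext)
  fix d
  have "ddiv k (1 :: alg fps) = 0" if "k \<noteq> 0" for k
  proof -
    have "cder 1 = 0" by (rule fps_ext) (use der_const[of 1] in auto)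
    then show ?thesis using that
      by (cases k) (simp_all add: ddiv_def cder_funpow_0 funpow_swap1 del: funpow.simps(2) add: funpow_Suc_right)
  qed
  then have "(\<Sum>k\<le>d. fps_nth (h ^ k * ddiv k 1) d) = (\<Sum>k\<in>{0}. fps_nth (h ^ k * ddiv k 1) d)"
    by (intro sum.mono_neutral_right) auto
  then show "fps_nth (tshift h 1) d = fps_nth 1 d" by (simp add: tshift_def)
qed

lemma tshift_power: "fps_nth h 0 = 0 \<Longrightarrow> tshift h (F ^ n) = tshift h F ^ n"
  by (induction n) (simp_all add: tshift_mult)

text \<open>Reads \<open>F((t + g) + h(t + g))\<close>: \<open>tshift g\<close> is multiplicative,
  hence turns \<open>h ^ k\<close> into \<open>v ^ k\<close> with \<open>v = tshift g h\<close>, and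
  the binomial theorem merges the powers of \<open>g\<close> and \<open>v\<close> into
  \<open>(g + v) ^ n\<close>.\<close>

lemma tshift_tshift:
  assumes g: "fps_nth g 0 = 0" and h: "fps_nth h 0 = 0"
  shows "tshift g (tshift h F) = tshift (g + tshift g h) F"
proof (rule fps_ext)
  fix N
  define v where "v = tshift g h"
  have v: "fps_nth v 0 = 0" using h by (simp add: v_def tshift_nth_0)
  have gv: "fps_nth (g + v) 0 = 0" using g v by simp
  let ?c = "\<lambda>j k. scal (of_nat ((j + k) choose j)) * ddiv (j + k) F"
  have "fps_nth (tshift g (tshift h F)) N = fps_nth (tshift g (\<Sum>k\<le>N. h ^ k * ddiv k F)) N"
    using h by (intro tshift_nth_cong) (simp only: tshift_nth[of h _ N])
  also have "tshift g (\<Sum>k\<le>N. h ^ k * ddiv k F) = (\<Sum>k\<le>N. v ^ k * tshift g (ddiv k F))"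
    using g by (simp add: tshift_sum tshift_mult tshift_power v_def)
  also have "fps_nth \<dots> N = (\<Sum>k\<le>N. fps_nth (v ^ k * (\<Sum>j\<le>N. g ^ j * ddiv j (ddiv k F))) N)"
    unfolding fps_sum_nth using g
    by (intro sum.cong fps_nth_mult_cong refl) (simp only: tshift_nth[of g _ N])
  also have "\<dots> = (\<Sum>k\<le>N. \<Sum>j\<le>N. fps_nth (g ^ j * (v ^ k * ?c j k)) N)"
    by (simp add: ddiv_ddiv fps_sum_nth sum_distrib_left mult_ac)
  also have "\<dots> = (\<Sum>j\<le>N. \<Sum>k\<le>N. fps_nth (g ^ j * (v ^ k * ?c j k)) N)"
    by (rule sum.swap)
  also have "\<dots> = (\<Sum>n\<le>N. \<Sum>j\<le>n. fps_nth (g ^ j * (v ^ (n - j) * ?c j (n - j))) N)"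
  proof (rule sum_square_triangle)
    fix j k assume jk: "N < j + k"
    have "fps_nth (g ^ j * v ^ k) i = 0" if "i < j + k" for i
    proof -
      have "fps_nth (g ^ j) a * fps_nth (v ^ k) (i - a) = 0" if "a \<le> i" for a
        using startsby_zero_power_prefix[OF g, of j] startsby_zero_power_prefix[OF v, of k]
          \<open>i < j + k\<close> that by (cases "a < j") auto
      then show ?thesis unfolding fps_mult_nth by (intro sum.neutral) simp
    qed
    then have "fps_nth ((g ^ j * v ^ k) * ?c j k) N = 0"
      unfolding fps_mult_nth[of "g ^ j * v ^ k"] using jk by simp
    then show "fps_nth (g ^ j * (v ^ k * ?c j k)) N = 0" by (simp only: mult.assoc)
  qed
  also have "\<dots> = (\<Sum>n\<le>N. fps_nth ((g + v) ^ n * ddiv n F) N)"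
  proof (intro sum.cong refl)
    fix n
    have "(g + v) ^ n * ddiv n F = (\<Sum>j\<le>n. g ^ j * (v ^ (n - j) * ?c j (n - j)))"
      unfolding binomial_ring sum_distrib_right
      by (intro sum.cong refl) (simp add: scal_of_nat mult.assoc mult.left_commute)
    then show "(\<Sum>j\<le>n. fps_nth (g ^ j * (v ^ (n - j) * ?c j (n - j))) N)
        = fps_nth ((g + v) ^ n * ddiv n F) N"
      by (simp only: fps_sum_nth)
  qed
  also have "\<dots> = fps_nth (tshift (g + v) F) N"
    by (simp add: tshift_def)
  finally show "fps_nth (tshift g (tshift h F)) N = fps_nth (tshift (g + tshift g h) F) N"
    by (simp add: v_def)
qed

section \<open>The flow of a substitution and its generator\<close>

definition delta :: "alg fps \<Rightarrow> alg fps \<Rightarrow> alg fps" where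
  "delta X F = tshift X F - F"

lemma delta_0 [simp]: "delta X 0 = 0"
  by (simp add: delta_def)

lemma delta_add: "delta X (F + G) = delta X F + delta X G"
  by (simp add: delta_def tshift_add)

lemma delta_sum: "delta X (\<Sum>i\<in>A. f i) = (\<Sum>i\<in>A. delta X (f i))"
  by (induction A rule: infinite_finite_induct) (simp_all add: delta_add)

lemma delta_of_nat_mult: "delta X (of_nat n * F) = of_nat n * delta X F"
  by (induction n) (simp_all add: delta_add distrib_right)

lemma delta_nth:
  assumes "fps_nth X 0 = 0"
  shows "fps_nth (delta X F) d = (\<Sum>k=1..d. fps_nth (X ^ k * ddiv k F) d)"
proof -
  have "{..d} = insert 0 {1..d}" by auto
  then show ?thesis by (simp add: delta_def tshift_def)
qed

text \<open>Each summand has a factor \<open>X ^ k\<close> with \<open>k \<ge> 1\<close>, so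
  \<open>delta X\<close> raises the lowest degree by at least one and its powers die out in every
  fixed degree.\<close>

lemma delta_nth_eq_0:
  assumes X: "fps_nth X 0 = 0" and F: "\<And>e. e < d \<Longrightarrow> fps_nth F e = 0" and "e \<le> d"
  shows "fps_nth (delta X F) e = 0"
  unfolding delta_nth[OF X]
proof (intro sum.neutral ballI)
  fix k assume k: "k \<in> {1..e}"
  have "fps_nth (X ^ k) i * fps_nth (ddiv k F) (e - i) = 0" if "i \<le> e" for i
  proof (cases "i = 0")
    case True
    then show ?thesis using startsby_zero_power_prefix[OF X, of k] k by simp
  next
    case False
    then show ?thesis using ddiv_nth_0[OF F] \<open>e \<le> d\<close> that by simp
  qed
  then show "fps_nth (X ^ k * ddiv k F) e = 0"
    unfolding fps_mult_nth by (intro sum.neutral) simp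
qed

lemma delta_funpow_nth_eq_0:
  assumes X: "fps_nth X 0 = 0" and "d \<le> i"
  shows "fps_nth ((delta X ^^ i) X) d = 0"
  using assms(2)
proof (induction i arbitrary: d)
  case (Suc i)
  have "fps_nth (delta X ((delta X ^^ i) X)) d = 0"
    by (rule delta_nth_eq_0[OF X _ Suc.prems]) (simp add: Suc.IH)
  then show ?case by simp
qed (use X in simp)

text \<open>The displacement of the \<open>n\<close>-fold iterate of \<open>t -> t + X(t)\<close>:
  the step taken after \<open>i\<close> iterations is \<open>X\<close> at the current position, that
  is \<open>T^i X\<close> with \<open>T = tshift X\<close>.\<close>

definition flow :: "alg fps \<Rightarrow> nat \<Rightarrow> alg fps" where
  "flow X n = (\<Sum>i<n. (tshift X ^^ i) X)"

lemma flow_0 [simp]: "flow X 0 = 0"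
  by (simp add: flow_def)

lemma flow_1 [simp]: "flow X (Suc 0) = X"
  by (simp add: flow_def)

lemma flow_Suc: "flow X (Suc n) = X + tshift X (flow X n)"
  unfolding flow_def sum.lessThan_Suc_shift by (simp add: tshift_sum)

lemma flow_nth_0: "fps_nth X 0 = 0 \<Longrightarrow> fps_nth (flow X n) 0 = 0"
  by (induction n) (simp_all add: flow_Suc tshift_nth_0)

lemma tshift_funpow:
  assumes "fps_nth X 0 = 0"
  shows "(tshift X ^^ n) F = tshift (flow X n) F"
  by (induction n) (simp_all add: tshift_tshift assms flow_nth_0 flow_Suc)

text \<open>Cocycle law of the iteration: the last \<open>m\<close> steps are those of
  \<open>flow X m\<close>, transported by \<open>T^n = tshift (flow X n)\<close>.\<close>

lemma flow_add:
  assumes "fps_nth X 0 = 0"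
  shows "flow X (n + m) = flow X n + tshift (flow X n) (flow X m)"
proof (induction m)
  case (Suc m)
  have "flow X (n + Suc m) = flow X (n + m) + (tshift X ^^ n) ((tshift X ^^ m) X)"
    by (simp add: flow_def funpow_add)
  also have "\<dots> = flow X n + tshift (flow X n) (flow X m + (tshift X ^^ m) X)"
    by (simp add: Suc tshift_add tshift_funpow[OF assms, of n])
  finally show ?case by (simp add: flow_def)
qed simp

text \<open>A geometric sum of powers of \<open>T = 1 + E\<close> with \<open>E = delta X\<close>;
  Pascal's rule drives the induction.\<close>

lemma flow_binomial: "flow X n = (\<Sum>i<n. of_nat (n choose Suc i) * (delta X ^^ i) X)"
proof (induction n)
  case (Suc n)
  let ?d = "\<lambda>i. (delta X ^^ i) X"
  have "flow X (Suc n) = flow X n + (X + delta X (flow X n))"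
    by (simp add: flow_Suc delta_def)
  also have "X + delta X (flow X n) = (\<Sum>i<Suc n. of_nat (n choose i) * ?d i)"
    unfolding Suc delta_sum sum.lessThan_Suc_shift by (simp add: delta_of_nat_mult)
  also have "flow X n = (\<Sum>i<Suc n. of_nat (n choose Suc i) * ?d i)"
    by (simp add: Suc)
  finally show ?case
    by (simp only: sum.distrib[symmetric] distrib_right[symmetric] of_nat_add[symmetric]
        binomial_Suc_Suc add.commute)
qed simp

section \<open>Polynomial dependence on the number of iterations\<close>

lemma of_nat_mult_nth: "fps_nth (of_nat c * F :: alg fps) d = of_nat c * fps_nth F d"
  by (induction c) (simp_all add: distrib_right)

text \<open>The summation bound becomes \<open>d\<close>, independent of \<open>n\<close>, which
  makes each component a polynomial in \<open>n\<close>.\<close>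

lemma flow_nth:
  assumes X: "fps_nth X 0 = 0"
  shows "fps_nth (flow X n) d = (\<Sum>i<d. of_nat (n choose Suc i) * fps_nth ((delta X ^^ i) X) d)"
proof -
  let ?f = "\<lambda>i. of_nat (n choose Suc i) * fps_nth ((delta X ^^ i) X) d"
  have "fps_nth (flow X n) d = (\<Sum>i<n. ?f i)"
    unfolding flow_binomial by (simp add: fps_sum_nth of_nat_mult_nth)
  \<comment> \<open>Beyond \<open>n\<close> the binomial coefficients vanish, beyond
    \<open>d\<close> the powers of \<open>delta X\<close> do; \<open>max n d\<close> covers both
    ranges.\<close>
  also have "\<dots> = (\<Sum>i<max n d. ?f i)"
    by (intro sum.mono_neutral_left) (auto simp: binomial_eq_0)
  also have "\<dots> = (\<Sum>i<d. ?f i)"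
    by (intro sum.mono_neutral_right) (auto simp: delta_funpow_nth_eq_0[OF X])
  finally show ?thesis .
qed

text \<open>Formally \<open>log(1 + E) / E\<close> applied to \<open>X\<close>, with
  \<open>E = delta X\<close>. For \<open>X\<close> without constant term the bound
  \<open>i < d\<close> loses nothing, as later powers vanish in degree \<open>d\<close>.\<close>

definition shift_log :: "alg fps \<Rightarrow> alg fps" where
  "shift_log X = Abs_fps (\<lambda>d. \<Sum>i<d. const ((-1) ^ i / of_nat (Suc i)) * fps_nth ((delta X ^^ i) X) d)"

definition binomial_poly :: "nat \<Rightarrow> alg poly" where
  "binomial_poly j = smult (const (1 / fact j)) (\<Prod>k<j. [:- of_nat k, 1:])"

lemma const_prod: "const (\<Prod>i\<in>A. f i) = (\<Prod>i\<in>A. const (f i))"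
  by (induction A rule: infinite_finite_induct) (simp_all add: const_mult)

lemma const_diff: "const (a - b) = const a - const b"
  using const_add[of "a - b" b] by simp

lemma poly_binomial_poly: "poly (binomial_poly j) (of_nat n) = of_nat (n choose j)"
proof -
  have "poly (binomial_poly j) (of_nat n) = const (1 / fact j * (\<Prod>k<j. of_nat n - of_nat k))"
    unfolding const_mult const_prod const_diff const_of_nat by (simp add: binomial_poly_def poly_prod)
  also have "1 / fact j * (\<Prod>k<j. of_nat n - of_nat k) = (of_nat (n choose j) :: rat)"
    by (simp add: binomial_gbinomial gbinomial_prod_rev atLeast0LessThan)
  finally show ?thesis by (simp add: const_of_nat)
qed

text \<open>The factor \<open>k = 0\<close> supplies the linear term; the others contribute their
  constant terms, with product \<open>(-1)^i i!\<close>, and the whole is divided by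
  \<open>(i + 1)!\<close>.\<close>

lemma coeff_binomial_poly_1:
  "coeff (binomial_poly (Suc i)) (Suc 0) = const ((-1) ^ i / of_nat (Suc i))"
proof -
  have "coeff (binomial_poly (Suc i)) (Suc 0)
      = const (1 / fact (Suc i)) * coeff (\<Prod>k<i. [:- of_nat (Suc k), 1:]) 0"
    unfolding binomial_poly_def prod.lessThan_Suc_shift by (simp del: fact_Suc)
  also have "coeff (\<Prod>k<i. [:- of_nat (Suc k), 1:] :: alg poly) 0 = (\<Prod>k<i. - of_nat (Suc k))"
    unfolding poly_0_coeff_0[symmetric] poly_prod by simp
  also have "\<dots> = const (\<Prod>k<i. - of_nat (Suc k))"
    by (simp only: const_prod const_uminus const_of_nat)
  also have "(\<Prod>k<i. - of_nat (Suc k)) = (-1) ^ i * (fact i :: rat)"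
    by (induction i) (simp_all add: algebra_simps)
  also have "const (1 / fact (Suc i)) * const ((-1) ^ i * fact i) = const ((-1) ^ i / of_nat (Suc i))"
  proof -
    have "1 / fact (Suc i) * ((-1) ^ i * fact i) = ((-1) ^ i / of_nat (Suc i) :: rat)"
      unfolding fact_Suc by (simp del: of_nat_Suc)
    then show ?thesis by (simp only: const_mult[symmetric])
  qed
  finally show ?thesis .
qed

definition flow_poly :: "alg fps \<Rightarrow> nat \<Rightarrow> alg poly" where
  "flow_poly X d = (\<Sum>i<d. smult (fps_nth ((delta X ^^ i) X) d) (binomial_poly (Suc i)))"

lemma poly_flow_poly:
  "fps_nth X 0 = 0 \<Longrightarrow> poly (flow_poly X d) (of_nat n) = fps_nth (flow X n) d"
  by (simp add: flow_poly_def poly_sum poly_binomial_poly flow_nth mult.commute)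

lemma coeff_flow_poly_1: "coeff (flow_poly X d) (Suc 0) = fps_nth (shift_log X) d"
  by (simp add: flow_poly_def coeff_sum coeff_binomial_poly_1 shift_log_def mult.commute)

text \<open>A purely algebraic form of \<open>f(n) = f(0) + n b + O(n\<^sup>2)\<close>, the derivative at \<open>n = 0\<close>.\<close>

definition jet :: "(nat \<Rightarrow> alg fps) \<Rightarrow> alg fps \<Rightarrow> bool" where
  "jet f b \<longleftrightarrow> (\<forall>d. \<exists>q. (\<forall>n. fps_nth (f n) d = poly q (of_nat n)) \<and> coeff q (Suc 0) = fps_nth b d)"

text \<open>Identities are available at natural times only but are used coefficientwise; over a
  domain of characteristic 0 infinitely many agreements suffice.\<close>

lemma poly_eq_on_nat:
  fixes p q :: "'a :: {idom, ring_char_0} poly"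
  assumes "\<And>n. poly p (of_nat n) = poly q (of_nat n)"
  shows "p = q"
proof (rule ccontr)
  assume "p \<noteq> q"
  then have "finite {x. poly (p - q) x = 0}" by (intro poly_roots_finite) simp
  moreover have "range of_nat \<subseteq> {x. poly (p - q) x = 0}" using assms by auto
  ultimately have "finite (range (of_nat :: nat \<Rightarrow> 'a))" by (rule finite_subset[rotated])
  then show False using finite_imageD[OF _ inj_of_nat] by simp
qed

lemma jet_unique:
  assumes "jet f b" "jet f c" shows "b = c"
proof (rule fps_ext)
  fix d
  obtain q where "\<forall>n. fps_nth (f n) d = poly q (of_nat n)" "coeff q (Suc 0) = fps_nth b d"
    using assms(1) unfolding jet_def by blast
  moreover obtain r where "\<forall>n. fps_nth (f n) d = poly r (of_nat n)" "coeff r (Suc 0) = fps_nth c d"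
    using assms(2) unfolding jet_def by blast
  moreover have "q = r" using calculation by (intro poly_eq_on_nat) metis
  ultimately show "fps_nth b d = fps_nth c d" by simp
qed

lemma jet_const: "jet (\<lambda>_. F) 0"
  unfolding jet_def
proof
  fix d
  show "\<exists>q. (\<forall>n. fps_nth F d = poly q (of_nat n)) \<and> coeff q (Suc 0) = fps_nth 0 d"
    by (rule exI[of _ "[:fps_nth F d:]"]) simp
qed

lemma jet_add:
  assumes "jet f b" "jet g c" shows "jet (\<lambda>n. f n + g n) (b + c)"
  unfolding jet_def
proof
  fix d
  obtain q where "\<forall>n. fps_nth (f n) d = poly q (of_nat n)" "coeff q (Suc 0) = fps_nth b d"
    using assms(1) unfolding jet_def by blast
  moreover obtain r where "\<forall>n. fps_nth (g n) d = poly r (of_nat n)" "coeff r (Suc 0) = fps_nth c d"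
    using assms(2) unfolding jet_def by blast
  ultimately show "\<exists>q. (\<forall>n. fps_nth (f n + g n) d = poly q (of_nat n))
      \<and> coeff q (Suc 0) = fps_nth (b + c) d"
    by (intro exI[of _ "q + r"]) simp
qed

lemma jet_sum:
  "(\<And>i. i \<in> A \<Longrightarrow> jet (f i) (b i)) \<Longrightarrow> jet (\<lambda>n. \<Sum>i\<in>A. f i n) (\<Sum>i\<in>A. b i)"
  by (induction A rule: infinite_finite_induct) (auto intro: jet_add jet_const)

lemma jet_mult:
  assumes "jet f b" "jet g c" shows "jet (\<lambda>n. f n * g n) (f 0 * c + b * g 0)"
  unfolding jet_def
proof
  fix d
  from assms obtain q r where
    q: "\<And>d n. fps_nth (f n) d = poly (q d) (of_nat n)" "\<And>d. coeff (q d) (Suc 0) = fps_nth b d" and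
    r: "\<And>d n. fps_nth (g n) d = poly (r d) (of_nat n)" "\<And>d. coeff (r d) (Suc 0) = fps_nth c d"
    unfolding jet_def by metis
  have 0: "coeff (q d) 0 = fps_nth (f 0) d" "coeff (r d) 0 = fps_nth (g 0) d" for d
    using q(1)[of 0 d] r(1)[of 0 d] by (simp_all add: poly_0_coeff_0)
  show "\<exists>p. (\<forall>n. fps_nth (f n * g n) d = poly p (of_nat n))
      \<and> coeff p (Suc 0) = fps_nth (f 0 * c + b * g 0) d"
    by (rule exI[of _ "\<Sum>i=0..d. q i * r (d - i)"])
      (simp add: fps_mult_nth poly_sum q r 0 coeff_sum coeff_mult sum.distrib)
qed

text \<open>As \<open>f 0 = 0\<close>, powers from the second on have order at least two in
  \<open>n\<close>.\<close>

lemma jet_power: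
  assumes "jet f b" "f 0 = 0" shows "jet (\<lambda>n. f n ^ k) (if k = 1 then b else 0)"
proof (induction k)
  case 0
  then show ?case using jet_const[of 1] by simp
next
  case (Suc k)
  have "f 0 * (if k = 1 then b else 0) + b * f 0 ^ k = (if Suc k = 1 then b else 0)"
    using assms(2) by (cases k) auto
  then show ?case using jet_mult[OF assms(1) Suc] by simp
qed

text \<open>The comparison function may change with the degree, which lets an infinite sum be
  replaced by its truncations.\<close>

lemma jet_local:
  assumes "\<And>d. \<exists>g c. jet g c \<and> (\<forall>n. fps_nth (f n) d = fps_nth (g n) d) \<and> fps_nth b d = fps_nth c d"
  shows "jet f b"
  unfolding jet_def
proof
  fix d
  from assms[of d] obtain g c where "jet g c" "\<forall>n. fps_nth (f n) d = fps_nth (g n) d"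
    "fps_nth b d = fps_nth c d" by blast
  then show "\<exists>q. (\<forall>n. fps_nth (f n) d = poly q (of_nat n)) \<and> coeff q (Suc 0) = fps_nth b d"
    unfolding jet_def by metis
qed

text \<open>Of the terms \<open>f n ^ k * ddiv k F\<close>, only \<open>k = 1\<close> has a linear
  part in \<open>n\<close>.\<close>

lemma jet_tshift:
  assumes f: "jet f b" "f 0 = 0" "\<And>n. fps_nth (f n) 0 = 0"
  shows "jet (\<lambda>n. tshift (f n) F) (b * cder F)"
proof (rule jet_local)
  fix d
  \<comment> \<open>Truncating at \<open>Suc d\<close> rather than \<open>d\<close> keeps the index
    1 in range when \<open>d = 0\<close>.\<close>
  let ?g = "\<lambda>n. \<Sum>k\<le>Suc d. f n ^ k * ddiv k F"
  have "jet (\<lambda>n. f n ^ k * ddiv k F) ((if k = 1 then b else 0) * ddiv k F)" for k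
    using jet_mult[OF jet_power[OF f(1,2)] jet_const] by simp
  then have "jet ?g (\<Sum>k\<le>Suc d. (if k = 1 then b else 0) * ddiv k F)"
    by (rule jet_sum)
  also have "(\<Sum>k\<le>Suc d. (if k = 1 then b else 0) * ddiv k F)
      = (\<Sum>k\<in>{1}. (if k = 1 then b else 0) * ddiv k F)"
    by (intro sum.mono_neutral_right) auto
  finally have "jet ?g (b * cder F)" by simp
  moreover have "fps_nth (tshift (f n) F) d = fps_nth (?g n) d" for n
    by (rule tshift_nth[OF f(3)]) simp
  ultimately show "\<exists>g c. jet g c \<and> (\<forall>n. fps_nth (tshift (f n) F) d = fps_nth (g n) d)
      \<and> fps_nth (b * cder F) d = fps_nth c d" by blast
qed

lemma jet_flow: "fps_nth X 0 = 0 \<Longrightarrow> jet (flow X) (shift_log X)"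
  unfolding jet_def using poly_flow_poly coeff_flow_poly_1 by metis

section \<open>The differential equation in the time variable\<close>

lemma jet_flow_shift:
  assumes "fps_nth X 0 = 0"
  shows "jet (\<lambda>n. flow X (n + m)) (Abs_fps (\<lambda>d. poly (pderiv (flow_poly X d)) (of_nat m)))"
  unfolding jet_def
proof
  fix d
  \<comment> \<open>Translating the polynomial by \<open>m\<close> turns its derivative at
    \<open>m\<close> into the linear coefficient at 0.\<close>
  let ?q = "pcompose (flow_poly X d) [:of_nat m, 1:]"
  have "coeff ?q (Suc 0) = poly (pderiv ?q) 0"
    by (simp add: poly_0_coeff_0 coeff_pderiv)
  also have "\<dots> = poly (pderiv (flow_poly X d)) (of_nat m)"
    by (simp add: pderiv_pcompose poly_pcompose pderiv_pCons)
  finally have "coeff ?q (Suc 0) = poly (pderiv (flow_poly X d)) (of_nat m)" .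
  moreover have "fps_nth (flow X (n + m)) d = poly ?q (of_nat n)" for n
    using poly_flow_poly[OF assms, of d "n + m"] by (simp add: poly_pcompose add.commute)
  ultimately show "\<exists>q. (\<forall>n. fps_nth (flow X (n + m)) d = poly q (of_nat n)) \<and>
      coeff q (Suc 0) = fps_nth (Abs_fps (\<lambda>d. poly (pderiv (flow_poly X d)) (of_nat m))) d"
    by auto
qed

text \<open>Both sides are the linear term in \<open>n\<close> of \<open>flow X (n + m)\<close>,
  computed once from its polynomial and once from \<open>flow_add\<close>.\<close>

lemma flow_ode:
  assumes X: "fps_nth X 0 = 0"
  shows "Abs_fps (\<lambda>d. poly (pderiv (flow_poly X d)) (of_nat m))
    = shift_log X + shift_log X * cder (flow X m)"
proof (rule jet_unique[OF jet_flow_shift[OF X]])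
  have "jet (\<lambda>n. flow X n + tshift (flow X n) (flow X m))
      (shift_log X + shift_log X * cder (flow X m))"
    using X by (intro jet_add jet_tshift jet_flow flow_nth_0) simp_all
  then show "jet (\<lambda>n. flow X (n + m)) (shift_log X + shift_log X * cder (flow X m))"
    by (simp add: flow_add[OF X])
qed

text \<open>Here \<open>n\<close> is the exponent of the time variable, not the number of
  iterations.\<close>

definition flow_coeff :: "alg fps \<Rightarrow> nat \<Rightarrow> alg fps" where
  "flow_coeff X n = Abs_fps (\<lambda>d. coeff (flow_poly X d) n)"

text \<open>Natural numbers are constants for the derivation, so evaluation at one commutes with
  differentiating the coefficients.\<close>

lemma poly_map_poly_der: "poly (map_poly der p) (of_nat n) = der (poly p (of_nat n))"
proof -
  have c: "der (of_nat n * a) = of_nat n * der a" for n a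
    using der_const_mult[of "of_nat n" a] by (simp add: const_of_nat)
  show ?thesis
    by (induction p) (simp_all add: map_poly_pCons der_add c)
qed

text \<open>Coefficient comparison in \<open>h' = L + L \<partial>h\<close>, where the inhomogeneous
  term \<open>L\<close> only reaches exponent 0.\<close>

lemma flow_coeff_Suc:
  assumes X: "fps_nth X 0 = 0"
  shows "of_nat (Suc n) * flow_coeff X (Suc n)
    = (if n = 0 then shift_log X else 0) + shift_log X * cder (flow_coeff X n)"
proof (rule fps_ext)
  fix d
  let ?L = "fps_nth (shift_log X)"
  have "pderiv (flow_poly X d) =
      [:?L d:] + (\<Sum>i=0..d. smult (?L i) (map_poly der (flow_poly X (d - i))))"
  proof (rule poly_eq_on_nat)
    fix m
    show "poly (pderiv (flow_poly X d)) (of_nat m) = poly ([:?L d:]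
        + (\<Sum>i=0..d. smult (?L i) (map_poly der (flow_poly X (d - i))))) (of_nat m)"
      using arg_cong[OF flow_ode[OF X, of m], of "\<lambda>F. fps_nth F d"]
      by (simp add: fps_mult_nth poly_sum poly_map_poly_der poly_flow_poly[OF X])
  qed
  from arg_cong[OF this, of "\<lambda>p. coeff p n"]
  have "of_nat (Suc n) * coeff (flow_poly X d) (Suc n) = (if n = 0 then ?L d else 0)
      + (\<Sum>i=0..d. ?L i * der (coeff (flow_poly X (d - i)) n))"
    by (simp add: coeff_pderiv coeff_sum coeff_map_poly coeff_pCons split: nat.split del: of_nat_Suc)
  moreover have "fps_nth (of_nat (Suc n) * flow_coeff X (Suc n)) d
      = of_nat (Suc n) * coeff (flow_poly X d) (Suc n)"
    unfolding of_nat_mult_nth by (simp only: flow_coeff_def fps_nth_Abs_fps)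
  ultimately show "fps_nth (of_nat (Suc n) * flow_coeff X (Suc n)) d = fps_nth ((if n = 0 then
      shift_log X else 0) + shift_log X * cder (flow_coeff X n)) d"
    by (simp add: flow_coeff_def fps_mult_nth)
qed

lemma flow_coeff_0: "fps_nth X 0 = 0 \<Longrightarrow> flow_coeff X 0 = 0"
  using poly_flow_poly[of X _ 0] by (intro fps_ext) (simp add: flow_coeff_def poly_0_coeff_0)

text \<open>Deriving and then multiplying by \<open>L\<close> is right multiplication by
  \<open>L\<close>, which builds the left-nested powers; the factors \<open>n + 1\<close> accumulate
  to the factorial.\<close>

lemma flow_coeff_eq:
  assumes X: "fps_nth X 0 = 0"
  shows "flow_coeff X (Suc n) = scal (1 / fact (Suc n)) * prelie_pow (shift_log X) n"
proof (induction n)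
  case 0
  then show ?case using flow_coeff_Suc[OF X, of 0] by (simp add: flow_coeff_0[OF X])
next
  case (Suc n)
  have "scal (of_nat (Suc (Suc n))) * flow_coeff X (Suc (Suc n))
      = shift_log X * cder (scal (1 / fact (Suc n)) * prelie_pow (shift_log X) n)"
    unfolding scal_of_nat flow_coeff_Suc[OF X] Suc by (simp del: fact_Suc)
  also have "\<dots> = scal (1 / fact (Suc n)) * prelie_pow (shift_log X) (Suc n)"
    unfolding cder_scal prelie_pow.simps cprod_eq by (simp only: mult_ac)
  also have "1 / fact (Suc n) = of_nat (Suc (Suc n)) * (1 / fact (Suc (Suc n)) :: rat)"
    unfolding fact_Suc[of "Suc n"] by (simp del: of_nat_Suc fact_Suc)
  finally show ?case
    unfolding scal_mult mult.assoc by (rule scal_cancel[OF of_nat_neq_0])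
qed

lemma shift_log_nth_0: "fps_nth (shift_log X) 0 = 0"
  by (simp add: shift_log_def)

text \<open>\<open>prelie_pow Y n\<close> has \<open>n + 1\<close> factors of positive degree, so
  only \<open>n < d\<close> reaches degree \<open>d\<close>.\<close>

lemma prelie_exp_nth:
  assumes "fps_nth Y 0 = 0"
  shows "fps_nth (prelie_exp Y) d = (\<Sum>n<d. const (1 / fact (Suc n)) * fps_nth (prelie_pow Y n) d)"
proof -
  let ?a = "\<lambda>n. cscale (1 / fact (Suc n)) (prelie_pow Y n)"
  have z: "fps_nth (?a n) k = 0" if "k \<le> n" for n k
    using prelie_pow_nth_eq_0[OF assms that] by (simp add: cscale_def)
  have "?a sums Abs_fps (\<lambda>k. \<Sum>n<k. fps_nth (?a n) k)"
    unfolding sums_def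
  proof (rule tendsto_fpsI)
    fix k
    have "(\<Sum>n<N. fps_nth (?a n) k) = (\<Sum>n<k. fps_nth (?a n) k)" if "N \<ge> k" for N
      using that z by (intro sum.mono_neutral_right) auto
    then show "\<forall>\<^sub>F N in sequentially. fps_nth (\<Sum>n<N. ?a n) k
        = fps_nth (Abs_fps (\<lambda>k. \<Sum>n<k. fps_nth (?a n) k)) k"
      unfolding eventually_at_top_linorder fps_sum_nth fps_nth_Abs_fps by blast
  qed
  then show ?thesis by (simp add: prelie_exp_def sums_unique[symmetric] cscale_def)
qed

text \<open>The flow at time 1 is \<open>X\<close>, while its coefficients in time are the terms of
  the exponential.\<close>

lemma prelie_exp_shift_log:
  assumes X: "fps_nth X 0 = 0"
  shows "prelie_exp (shift_log X) = X"
proof (rule fps_ext)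
  fix d
  let ?p = "flow_poly X d"
  have c: "coeff ?p (Suc n) = const (1 / fact (Suc n)) * fps_nth (prelie_pow (shift_log X) n) d" for n
    using arg_cong[OF flow_coeff_eq[OF X, of n], of "\<lambda>F. fps_nth F d"]
    by (simp add: flow_coeff_def del: fact_Suc)
  \<comment> \<open>This replaces the unknown degree of \<open>?p\<close> by the bound
    \<open>d\<close>.\<close>
  have z: "coeff ?p n = 0" if "d < n" for n
    using that c[of "n - 1"] prelie_pow_nth_eq_0[OF shift_log_nth_0, of d "n - 1" X] by simp
  have "fps_nth X d = poly ?p (of_nat 1)"
    using poly_flow_poly[OF X, of d 1] by simp
  also have "\<dots> = (\<Sum>n\<le>d. coeff ?p n)"
  proof -
    have "poly ?p 1 = (\<Sum>n\<le>degree ?p. coeff ?p n)" by (simp add: poly_altdef)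
    also have "\<dots> = (\<Sum>n\<le>d. coeff ?p n)"
      using z by (intro sum.mono_neutral_left) (auto simp: degree_le coeff_eq_0)
    finally show ?thesis by simp
  qed
  also have "\<dots> = coeff ?p 0 + (\<Sum>n<d. coeff ?p (Suc n))"
    unfolding lessThan_Suc_atMost[symmetric] sum.lessThan_Suc_shift ..
  also have "coeff ?p 0 = 0"
    using arg_cong[OF flow_coeff_0[OF X], of "\<lambda>F. fps_nth F d"] by (simp add: flow_coeff_def)
  finally show "fps_nth (prelie_exp (shift_log X)) d = fps_nth X d"
    by (simp add: c prelie_exp_nth[OF shift_log_nth_0] del: fact_Suc)
qed

section \<open>Injectivity of the pre-Lie exponential\<close>

text \<open>In a product of at least two factors without constant term, each factor enters degree
  \<open>d\<close> only through components below \<open>d\<close>.\<close>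

lemma prelie_pow_Suc_nth_cong:
  assumes "fps_nth Y 0 = 0" "fps_nth Z 0 = 0" "\<And>e. e < d \<Longrightarrow> fps_nth Y e = fps_nth Z e"
  shows "fps_nth (prelie_pow Y (Suc n)) d = fps_nth (prelie_pow Z (Suc n)) d"
  using assms(3)
proof (induction n arbitrary: d)
  case (0 d)
  have "fps_nth Y i \<triangleleft> fps_nth Y (d - i) = fps_nth Z i \<triangleleft> fps_nth Z (d - i)" if "i \<le> d" for i
    using that 0 assms(1,2) by (cases "i = 0"; cases "i = d") (simp_all add: nov_prod_def)
  then show ?case by (simp add: cprod_def)
next
  case (Suc n d)
  have z: "fps_nth (prelie_pow V (Suc n)) 0 = 0" if "fps_nth V 0 = 0" for V
    using prelie_pow_nth_eq_0[OF that, of 0 "Suc n"] by blast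
  have "fps_nth (prelie_pow Y (Suc n)) i \<triangleleft> fps_nth Y (d - i)
      = fps_nth (prelie_pow Z (Suc n)) i \<triangleleft> fps_nth Z (d - i)" if "i \<le> d" for i
  proof -
    have "i = 0 \<or> i = d \<or> (i < d \<and> d - i < d)" using that by auto
    then consider "i = 0" | "i = d" | "i < d" "d - i < d" by blast
    then show ?thesis
    proof cases
      case 3
      then show ?thesis using Suc.IH[of i] Suc.prems by simp
    qed (use z assms(1,2) in \<open>simp_all only: nov_prod_def der_0 mult_zero_left mult_zero_right diff_self_eq_0\<close>)
  qed
  then show ?case
    unfolding prelie_pow.simps(2)[of _ "Suc n"] cprod_def fps_nth_Abs_fps
    by (intro sum.cong refl) (simp only: atMost_iff)
qed

text \<open>In degree \<open>d\<close> the exponential is the component of \<open>Y\<close> itself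
  plus terms fixed by lower components, so \<open>Y\<close> is recovered degree by degree.\<close>

lemma prelie_exp_inj:
  assumes YZ: "fps_nth Y 0 = 0" "fps_nth Z 0 = 0" and eq: "prelie_exp Y = prelie_exp Z"
  shows "Y = Z"
proof -
  have "fps_nth Y d = fps_nth Z d" for d
  proof (induction d rule: less_induct)
    case (less d)
    show ?case
    proof (cases d)
      case (Suc e)
      have split: "fps_nth (prelie_exp V) d = fps_nth V d
          + (\<Sum>n<e. const (1 / fact (Suc (Suc n))) * fps_nth (prelie_pow V (Suc n)) d)"
        if "fps_nth V 0 = 0" for V
        unfolding prelie_exp_nth[OF that] Suc sum.lessThan_Suc_shift by simp
      have "fps_nth (prelie_pow Y (Suc n)) d = fps_nth (prelie_pow Z (Suc n)) d" for n
        using prelie_pow_Suc_nth_cong[OF YZ] less by blast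
      then show ?thesis
        using split[OF YZ(1)] split[OF YZ(2)] eq by (simp only: add_right_cancel)
    qed (use YZ in simp)
  qed
  then show ?thesis by (rule fps_ext)
qed

section \<open>Monomials and partitions\<close>

lemma lookup_const_mult: "Poly_Mapping.lookup (const c * f) m = c * Poly_Mapping.lookup f m"
proof (induction f rule: alg_induct)
  case (single n d)
  then show ?case by (simp add: const_def mult_single lookup_single when_def)
qed (simp_all add: distrib_left lookup_add)

text \<open>One form for all additive statistics of a monomial: degree, weight and, later, the
  number of factors with index at least \<open>j\<close>.\<close>

definition msum :: "(nat \<Rightarrow> int) \<Rightarrow> monom \<Rightarrow> int" where
  "msum \<phi> m = (\<Sum>j\<in>Poly_Mapping.keys m. \<phi> j * int (Poly_Mapping.lookup m j))"

lemma msum_superset: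
  "finite S \<Longrightarrow> Poly_Mapping.keys m \<subseteq> S \<Longrightarrow> msum \<phi> m = (\<Sum>j\<in>S. \<phi> j * int (Poly_Mapping.lookup m j))"
  unfolding msum_def by (intro sum.mono_neutral_left) (auto simp: in_keys_iff)

lemma msum_add: "msum \<phi> (m + n) = msum \<phi> m + msum \<phi> n"
proof -
  let ?S = "Poly_Mapping.keys m \<union> Poly_Mapping.keys n"
  have "msum \<phi> h = (\<Sum>j\<in>?S. \<phi> j * int (Poly_Mapping.lookup h j))" if "h \<in> {m, n, m + n}" for h
    using that Poly_Mapping.keys_add[of m n] by (intro msum_superset) auto
  then show ?thesis by (simp add: lookup_add distrib_left sum.distrib)
qed

lemma msum_single: "msum \<phi> (Poly_Mapping.single j c) = \<phi> j * int c"
  by (cases "c = 0") (simp_all add: msum_def)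

lemma mweight_eq_msum: "mweight m = msum (\<lambda>j. int j - 1) m"
  by (simp add: mweight_def msum_def)

lemma mdeg_eq_msum: "int (mdeg m) = msum (\<lambda>_. 1) m"
  by (simp add: mdeg_def msum_def)

lemma keys_der:
  assumes "m' \<in> Poly_Mapping.keys (der f)"
  obtains m j r where "m \<in> Poly_Mapping.keys f" "m = Poly_Mapping.single j 1 + r"
    "m' = Poly_Mapping.single (Suc j) 1 + r"
proof -
  have ks: "\<exists>i\<in>A. x \<in> Poly_Mapping.keys (g i)" if "x \<in> Poly_Mapping.keys (\<Sum>i\<in>A. g i :: alg)"
    for x A and g :: "'a \<Rightarrow> alg"
    using that keys_sum[of g A] by blast
  have kc: "x \<in> Poly_Mapping.keys g" if "x \<in> Poly_Mapping.keys (const c * g)" for x c and g :: alg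
    using that by (simp add: in_keys_iff lookup_const_mult)
  obtain m where m: "m \<in> Poly_Mapping.keys f" "m' \<in> Poly_Mapping.keys (der_monom m)"
    using ks[OF assms[unfolded der_def]] kc by blast
  obtain j where j: "j \<in> Poly_Mapping.keys m"
    "m' \<in> Poly_Mapping.keys (xv (Suc j) * xmonom (m - Poly_Mapping.single j 1))"
    using ks[OF m(2)[unfolded der_monom_def mult.assoc]] kc by blast
  have "m = Poly_Mapping.single j 1 + (m - Poly_Mapping.single j 1)"
    using j(1) by (intro poly_mapping_eqI)
      (auto simp: lookup_add lookup_minus lookup_single when_def in_keys_iff)
  moreover have "m' = Poly_Mapping.single (Suc j) 1 + (m - Poly_Mapping.single j 1)"
    using j(2) by (simp add: xv_def xmonom_def mult_single)
  ultimately show ?thesis using that m(1) by blast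
qed

text \<open>\<open>P\<close> is a property of increments stable under addition;
  \<open>0 \<le> x\<close> serves for tail counts and \<open>x = 0\<close> for the degree, with one
  shared induction.\<close>

lemma msum_keys_der_funpow:
  assumes "m' \<in> Poly_Mapping.keys ((der ^^ k) f)"
    and "\<And>j. P (\<phi> (Suc j) - \<phi> j)" "P 0" "\<And>a b. P a \<Longrightarrow> P b \<Longrightarrow> P (a + b)"
  shows "\<exists>m\<in>Poly_Mapping.keys f. P (msum \<phi> m' - msum \<phi> m)"
  using assms(1)
proof (induction k arbitrary: m')
  case (Suc k)
  then have "m' \<in> Poly_Mapping.keys (der ((der ^^ k) f))" by simp
  then obtain m j r where m: "m \<in> Poly_Mapping.keys ((der ^^ k) f)"
    "m = Poly_Mapping.single j 1 + r" "m' = Poly_Mapping.single (Suc j) 1 + r"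
    by (rule keys_der)
  from Suc.IH[OF m(1)] obtain n where n: "n \<in> Poly_Mapping.keys f" "P (msum \<phi> m - msum \<phi> n)"
    by blast
  have eq: "msum \<phi> m' - msum \<phi> n = (\<phi> (Suc j) - \<phi> j) + (msum \<phi> m - msum \<phi> n)"
    by (simp add: m msum_add msum_single)
  then have "P (msum \<phi> m' - msum \<phi> n)" unfolding eq using n(2) assms(2,4) by blast
  then show ?case using n(1) by blast
next
  case 0
  then show ?case using assms(3) by (intro bexI[of _ m']) simp_all
qed

section \<open>Bigrading by degree and weight\<close>

definition graded :: "nat \<Rightarrow> int \<Rightarrow> alg \<Rightarrow> bool" where
  "graded d w f \<longleftrightarrow> (\<forall>m\<in>Poly_Mapping.keys f. mdeg m = d \<and> mweight m = w)"

lemma graded_0 [simp]: "graded d w 0"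
  by (simp add: graded_def)

lemma graded_add: "graded d w f \<Longrightarrow> graded d w g \<Longrightarrow> graded d w (f + g)"
  using Poly_Mapping.keys_add[of f g] by (auto simp: graded_def)

lemma graded_sum: "(\<And>i. i \<in> A \<Longrightarrow> graded d w (f i)) \<Longrightarrow> graded d w (\<Sum>i\<in>A. f i)"
  by (induction A rule: infinite_finite_induct) (simp_all add: graded_add)

lemma graded_const_mult: "graded d w f \<Longrightarrow> graded d w (const c * f)"
  by (simp add: graded_def in_keys_iff lookup_const_mult)

lemma mdeg_add: "mdeg (m + n) = mdeg m + mdeg n"
  using msum_add[of "\<lambda>_. 1" m n] by (simp flip: mdeg_eq_msum)

lemma graded_mult: "graded d w f \<Longrightarrow> graded e v g \<Longrightarrow> graded (d + e) (w + v) (f * g)"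
  unfolding graded_def
proof
  fix m assume "m \<in> Poly_Mapping.keys (f * g)"
    and fg: "\<forall>m\<in>Poly_Mapping.keys f. mdeg m = d \<and> mweight m = w"
    "\<forall>m\<in>Poly_Mapping.keys g. mdeg m = e \<and> mweight m = v"
  then obtain a b where "m = a + b" "a \<in> Poly_Mapping.keys f" "b \<in> Poly_Mapping.keys g"
    using keys_mult[of f g] by auto
  then show "mdeg m = d + e \<and> mweight m = w + v"
    using fg by (simp add: mdeg_add mweight_eq_msum msum_add)
qed

lemma graded_xmonom: "graded (mdeg m) (mweight m) (xmonom m)"
  by (simp add: graded_def xmonom_def)

lemma mdeg_single: "mdeg (Poly_Mapping.single j c) = c"
  using msum_single[of "\<lambda>_. 1" j c] by (simp flip: mdeg_eq_msum)

lemma graded_gen: "graded 1 (-1) gen"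
  using graded_xmonom[of "Poly_Mapping.single 0 1"]
  by (simp add: xv_def mdeg_single mweight_eq_msum msum_single)

lemma graded_gen_power: "graded k (- int k) (gen ^ k)"
proof (induction k)
  case 0
  have "graded 0 0 (xmonom 0)" using graded_xmonom[of 0] by (simp add: mdeg_def mweight_def)
  then show ?case by (simp add: xmonom_def)
next
  case (Suc k)
  show ?case using graded_mult[OF graded_gen Suc] by (simp add: algebra_simps)
qed

lemma graded_der: "graded d w f \<Longrightarrow> graded d (w + 1) (der f)"
  unfolding graded_def
proof
  fix m' assume f: "\<forall>m\<in>Poly_Mapping.keys f. mdeg m = d \<and> mweight m = w"
    and "m' \<in> Poly_Mapping.keys (der f)"
  then obtain m j r where m: "m \<in> Poly_Mapping.keys f" "m = Poly_Mapping.single j 1 + r"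
    "m' = Poly_Mapping.single (Suc j) 1 + r" by (elim keys_der)
  then show "mdeg m' = d \<and> mweight m' = w + 1"
    using f by (auto simp: mdeg_add mdeg_single mweight_eq_msum msum_add msum_single)
qed

lemma graded_der_funpow: "graded d w f \<Longrightarrow> graded d (w + int k) ((der ^^ k) f)"
proof (induction k)
  case (Suc k)
  then show ?case using graded_der[of d "w + int k"] by (simp add: add_ac)
qed simp

text \<open>The weight \<open>-k\<close> of \<open>gen ^ k\<close> cancels the weight gained by
  \<open>k\<close> derivations, so braces by the generator preserve weight.\<close>

lemma graded_gen_power_der: "graded d w f \<Longrightarrow> graded (d + k) w (gen ^ k * (der ^^ k) f)"
  using graded_mult[OF graded_gen_power graded_der_funpow, of d w f k k] by (simp add: add.commute)

section \<open>Partitions as exponent vectors\<close>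

lemma lookup_sum_singles:
  "Poly_Mapping.lookup (\<Sum>j\<leftarrow>p. Poly_Mapping.single j (Suc 0)) i = count (mset p) i"
  by (induction p) (simp_all add: lookup_add lookup_single when_def)

lemma is_partition_sum_length: "is_partition p \<Longrightarrow> length p \<le> sum_list p"
  using sum_list_mono[of p "\<lambda>_. 1" "\<lambda>i. i"] by (simp add: is_partition_def sum_list_triv)

lemma msum_xpart_exp:
  "msum \<phi> (xpart_exp p) = (\<Sum>j\<leftarrow>p. \<phi> j) + \<phi> 0 * int (sum_list p - length p + 1)"
proof -
  have "msum \<phi> (\<Sum>j\<leftarrow>p. Poly_Mapping.single j 1) = (\<Sum>j\<leftarrow>p. \<phi> j)"
    by (induction p) (simp_all add: msum_add msum_single, simp add: msum_def)
  then show ?thesis by (simp add: xpart_exp_def msum_add msum_single)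
qed

lemma mdeg_xpart_exp: "is_partition p \<Longrightarrow> mdeg (xpart_exp p) = Suc (sum_list p)"
  using msum_xpart_exp[of "\<lambda>_. 1" p] is_partition_sum_length[of p]
  by (simp add: sum_list_triv flip: mdeg_eq_msum)

lemma mset_partition_inj:
  assumes "is_partition p" "is_partition q" "mset p = mset q"
  shows "p = q"
proof -
  have "sorted (rev p)" "sorted (rev q)" using assms by (simp_all add: is_partition_def sorted_wrt_rev)
  then have "rev p = rev q" using assms(3) by (metis mset_rev properties_for_sort)
  then show ?thesis by simp
qed

lemma count_partition_0: "is_partition p \<Longrightarrow> count (mset p) 0 = 0"
  by (auto simp: is_partition_def count_eq_zero_iff)

text \<open>Exponents at positive indices are the multiplicities of the parts; index 0 holds only
  the padding by \<open>xv 0\<close>, and no part is 0.\<close>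

lemma xpart_exp_inj:
  assumes "is_partition p" "is_partition q" "xpart_exp p = xpart_exp q"
  shows "p = q"
proof (rule mset_partition_inj[OF assms(1,2)], rule multiset_eqI)
  fix i
  show "count (mset p) i = count (mset q) i"
  proof (cases "i = 0")
    case False
    have "Poly_Mapping.lookup (xpart_exp p) i = Poly_Mapping.lookup (xpart_exp q) i"
      using assms(3) by simp
    then show ?thesis
      using False by (simp add: xpart_exp_def lookup_add lookup_sum_singles lookup_single when_def)
  qed (simp add: assms count_partition_0 del: count_eq_zero_iff)
qed

text \<open>The indices of the factors other than \<open>xv 0\<close> are the parts; degree and
  weight give two equations that fix the sum of the parts and the exponent of
  \<open>xv 0\<close>.\<close>

lemma ex_xpart_exp:
  assumes "mdeg m = Suc n" "mweight m = -1"
  shows "\<exists>p\<in>partitions n. m = xpart_exp p"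
proof -
  let ?c = "\<lambda>i. if i = 0 then 0 else Poly_Mapping.lookup m i"
  have "finite {i. 0 < ?c i}"
    by (rule finite_subset[OF _ finite_keys[of m]]) (auto simp: in_keys_iff split: if_splits)
  then have cnt: "count (Abs_multiset ?c) = ?c" by (rule count_Abs_multiset)
  define p where "p = rev (sorted_list_of_multiset (Abs_multiset ?c))"
  have cp: "count (mset p) i = ?c i" for i by (simp add: p_def cnt)
  have "0 \<notin> set p" using cp[of 0] by (simp add: count_eq_zero_iff)
  then have "1 \<le> i" if "i \<in> set p" for i using that by (cases i) auto
  then have part: "is_partition p"
    by (simp add: is_partition_def p_def sorted_wrt_rev)
  let ?s = "\<Sum>j\<leftarrow>p. Poly_Mapping.single j (1::nat)"
  have m: "m = ?s + Poly_Mapping.single 0 (Poly_Mapping.lookup m 0)"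
    by (rule poly_mapping_eqI) (simp add: lookup_add lookup_sum_singles lookup_single when_def cp)
  have s: "msum \<phi> ?s = (\<Sum>j\<leftarrow>p. \<phi> j)" for \<phi>
    by (induction p) (simp_all add: msum_add msum_single, simp add: msum_def)
  have ms: "msum \<phi> m = (\<Sum>j\<leftarrow>p. \<phi> j) + \<phi> 0 * int (Poly_Mapping.lookup m 0)" for \<phi>
    by (subst m) (simp only: msum_add s msum_single)
  have "(\<Sum>j\<leftarrow>p. int j - 1) = int (sum_list p) - int (length p)"
    by (induction p) simp_all
  then have "Poly_Mapping.lookup m 0 = sum_list p - length p + 1" "sum_list p = n"
    using ms[of "\<lambda>_. 1"] ms[of "\<lambda>j. int j - 1"] assms is_partition_sum_length[OF part]
    by (simp_all add: sum_list_triv flip: mdeg_eq_msum mweight_eq_msum)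
  then show ?thesis
    using m part unfolding partitions_def xpart_exp_def by auto
qed

lemma finite_partitions: "finite (partitions n)"
proof (rule finite_subset)
  show "partitions n \<subseteq> {p. set p \<subseteq> {..n} \<and> length p \<le> n}"
    using is_partition_sum_length by (auto simp: partitions_def member_le_sum_list)
  show "finite {p. set p \<subseteq> {..n} \<and> length p \<le> n}"
    by (rule finite_lists_length_le) simp
qed

text \<open>\<open>xpart_exp\<close> enumerates all monomials of this bidegree without repetition,
  so the expansion in monomials can be reindexed by partitions.\<close>

lemma graded_expand:
  assumes "graded (Suc n) (-1) f"
  shows "f = (\<Sum>p\<in>partitions n. const (Poly_Mapping.lookup f (xpart_exp p)) * xpart p)"
proof -
  let ?t = "\<lambda>m. const (Poly_Mapping.lookup f m) * xmonom m"
  have inj: "inj_on xpart_exp (partitions n)"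
    by (auto simp: inj_on_def partitions_def intro: xpart_exp_inj)
  have "f = (\<Sum>m\<in>Poly_Mapping.keys f. ?t m)"
    by (rule poly_mapping_eqI)
      (auto simp: lookup_sum lookup_const_mult xmonom_def lookup_single when_def in_keys_iff
        if_distrib[of "\<lambda>x. _ * x"] sum.delta' cong: if_cong)
  also have "\<dots> = (\<Sum>m\<in>xpart_exp ` partitions n. ?t m)"
  proof (rule sum.mono_neutral_left)
    show "Poly_Mapping.keys f \<subseteq> xpart_exp ` partitions n"
      using assms ex_xpart_exp by (fastforce simp: graded_def)
  qed (simp_all add: finite_partitions in_keys_iff)
  also have "\<dots> = (\<Sum>p\<in>partitions n. ?t (xpart_exp p))"
    by (simp add: sum.reindex[OF inj])
  finally show ?thesis by (simp only: xpart_eq_monom)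
qed

section \<open>Iterated braces\<close>

lemma finite_compositions: "finite (compositions i n)"
proof (rule finite_subset)
  show "compositions i n \<subseteq> {ks. set ks \<subseteq> {..n} \<and> length ks = i}"
    by (auto simp: compositions_def member_le_sum_list)
  show "finite {ks. set ks \<subseteq> {..n} \<and> length ks = i}"
    by (rule finite_lists_length_eq) simp
qed

text \<open>Splits off the last part, which \<open>iter_brace\<close> applies outermost.\<close>

lemma sum_compositions_Suc:
  "(\<Sum>ks\<in>compositions (Suc i) n. f ks) = (\<Sum>k=1..n. \<Sum>ks\<in>compositions i (n - k). f (ks @ [k]))"
proof -
  have "(\<Sum>k=1..n. \<Sum>ks\<in>compositions i (n - k). f (ks @ [k]))
      = (\<Sum>(k, ks)\<in>Sigma {1..n} (\<lambda>k. compositions i (n - k)). f (ks @ [k]))"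
    by (rule sum.Sigma) (auto simp: finite_compositions)
  also have "\<dots> = (\<Sum>ks\<in>compositions (Suc i) n. f ks)"
  proof (rule sum.reindex_bij_witness[where i = "\<lambda>ks. (last ks, butlast ks)"
        and j = "\<lambda>(k, ks). ks @ [k]"])
    fix ks assume ks: "ks \<in> compositions (Suc i) n"
    then have "ks \<noteq> []" by (auto simp: compositions_def)
    then obtain js k where "ks = js @ [k]" by (metis rev_exhaust)
    then show "(case (last ks, butlast ks) of (k, ks) \<Rightarrow> ks @ [k]) = ks"
      "(last ks, butlast ks) \<in> Sigma {1..n} (\<lambda>k. compositions i (n - k))"
      using ks by (auto simp: compositions_def)
  qed (auto simp: compositions_def)
  finally show ?thesis ..
qed

text \<open>The expression from which \<open>ncoef\<close> reads its coefficients; it turns out to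
  be the component of degree \<open>n + 1\<close> of \<open>E^i x\<close>.\<close>

definition brace_sum :: "nat \<Rightarrow> nat \<Rightarrow> alg" where
  "brace_sum i n = (\<Sum>ks\<in>compositions i n. const (1 / prod_list (map fact ks)) * iter_brace ks)"

lemma brace_gen: "brace f (replicate k gen) = gen ^ k * (der ^^ k) f"
  by (simp add: brace_def prod_list_replicate)

lemma der_funpow_add: "(der ^^ k) (f + g) = (der ^^ k) f + (der ^^ k) g"
  by (induction k) (simp_all add: der_add)

lemma der_funpow_0: "(der ^^ k) 0 = 0"
  by (induction k) simp_all

lemma der_funpow_sum: "(der ^^ k) (\<Sum>i\<in>A. f i) = (\<Sum>i\<in>A. (der ^^ k) (f i))"
  by (induction A rule: infinite_finite_induct) (simp_all add: der_funpow_add der_funpow_0)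

lemma der_funpow_const_mult: "(der ^^ k) (const c * f) = const c * (der ^^ k) f"
  by (induction k) (simp_all add: der_const_mult)

lemma compositions_0: "compositions 0 n = (if n = 0 then {[]} else {})"
  by (auto simp: compositions_def)

lemma brace_sum_0: "brace_sum 0 n = (if n = 0 then gen else 0)"
  by (simp add: brace_sum_def compositions_0 iter_brace_def)

text \<open>Recursion on the outermost brace, in the same shape as the components of
  \<open>delta (embed gen)\<close>.\<close>

lemma brace_sum_Suc:
  "brace_sum (Suc i) n = (\<Sum>k=1..n. const (1 / fact k) * (gen ^ k * (der ^^ k) (brace_sum i (n - k))))"
  unfolding brace_sum_def sum_compositions_Suc der_funpow_sum sum_distrib_left
proof (intro sum.cong refl)
  fix k ks
  have "1 / prod_list (map fact (ks @ [k])) = 1 / fact k * (1 / prod_list (map fact ks) :: rat)"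
    by simp
  then show "const (1 / prod_list (map fact (ks @ [k]))) * iter_brace (ks @ [k])
      = const (1 / fact k) * (gen ^ k * (der ^^ k) (const (1 / prod_list (map fact ks)) * iter_brace ks))"
    by (simp only: const_mult iter_brace_def foldl_append foldl.simps brace_gen
        der_funpow_const_mult mult_ac)
qed

lemma graded_brace_sum: "graded (Suc n) (-1) (brace_sum i n)"
proof (induction i arbitrary: n)
  case 0
  then show ?case using graded_gen by (simp add: brace_sum_0)
next
  case (Suc i)
  have "graded (Suc n) (-1) (gen ^ k * (der ^^ k) (brace_sum i (n - k)))" if "k \<in> {1..n}" for k
    using graded_gen_power_der[OF Suc.IH[of "n - k"], of k] that by simp
  then show ?case unfolding brace_sum_Suc by (intro graded_sum graded_const_mult)
qed

section \<open>The logarithm of the embedded generator\<close>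

lemma hom_part_graded:
  assumes "graded d w f" shows "hom_part n f = (if n = d then f else 0)"
proof -
  have "f = (\<Sum>m\<in>Poly_Mapping.keys f. Poly_Mapping.single m (Poly_Mapping.lookup f m))"
    by (rule poly_mapping_eqI)
      (auto simp: lookup_sum lookup_single when_def sum.delta' in_keys_iff)
  moreover have "{m. m \<in> Poly_Mapping.keys f \<and> mdeg m = n}
      = (if n = d then Poly_Mapping.keys f else {})"
    using assms by (auto simp: graded_def)
  ultimately show ?thesis by (simp add: hom_part_def)
qed

lemma embed_nth: "graded d w f \<Longrightarrow> fps_nth (embed f) n = (if n = d then f else 0)"
  by (simp add: embed_def hom_part_graded)

lemma embed_gen: "embed gen = fps_const gen * fps_X"
  by (rule fps_ext) (simp add: embed_nth[OF graded_gen])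

lemma embed_gen_nth: "fps_nth (embed gen) n = (if n = 1 then gen else 0)"
  by (rule embed_nth[OF graded_gen])

text \<open>The embedded generator is \<open>gen\<close> times the series variable, so its
  \<open>k\<close>-th power shifts the degree by exactly \<open>k\<close>.\<close>

lemma delta_embed_gen_nth:
  "fps_nth (delta (embed gen) F) d
    = (\<Sum>k=1..d. const (1 / fact k) * (gen ^ k * (der ^^ k) (fps_nth F (d - k))))"
proof -
  have "fps_nth (embed gen ^ k * ddiv k F) d
      = const (1 / fact k) * (gen ^ k * (der ^^ k) (fps_nth F (d - k)))" if "k \<in> {1..d}" for k
  proof -
    have "embed gen ^ k * ddiv k F = fps_const (gen ^ k) * (fps_X ^ k * ddiv k F)"
      by (simp only: embed_gen power_mult_distrib fps_const_power mult.assoc)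
    then have "fps_nth (embed gen ^ k * ddiv k F) d = gen ^ k * fps_nth (ddiv k F) (d - k)"
      using that by (simp only: fps_mult_left_const_nth fps_X_power_mult_nth) simp
    then show ?thesis
      by (simp only: ddiv_def scal_nth_mult cder_funpow_nth mult.left_commute)
  qed
  then show ?thesis
    by (subst delta_nth) (simp_all add: embed_gen_nth)
qed

lemma delta_funpow_embed_gen_nth:
  "fps_nth ((delta (embed gen) ^^ i) (embed gen)) (Suc n) = brace_sum i n"
proof (induction i arbitrary: n)
  case 0
  then show ?case by (simp add: embed_gen_nth brace_sum_0)
next
  case (Suc i)
  let ?F = "(delta (embed gen) ^^ i) (embed gen)"
  have z: "fps_nth ?F 0 = 0"
    by (rule delta_funpow_nth_eq_0) (simp_all add: embed_gen_nth)
  \<comment> \<open>The term \<open>k = Suc n\<close> drops out because \<open>?F\<close> has no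
    constant term; the upper limit then matches \<open>brace_sum\<close>.\<close>
  have "fps_nth (delta (embed gen) ?F) (Suc n)
      = (\<Sum>k=1..n. const (1 / fact k) * (gen ^ k * (der ^^ k) (fps_nth ?F (Suc n - k))))"
    unfolding delta_embed_gen_nth by (simp add: z der_funpow_0 der_0)
  also have "\<dots> = brace_sum (Suc i) n"
    unfolding brace_sum_Suc by (intro sum.cong refl) (simp add: Suc_diff_le Suc)
  finally show ?case by simp
qed

lemma pfact_nonzero: "pfact p \<noteq> 0"
  by (auto simp: pfact_def prod_list_zero_iff)

lemma ncoef_eq: "ncoef p (Suc i) = Poly_Mapping.lookup (brace_sum i (sum_list p)) (xpart_exp p) * pfact p"
  by (simp add: ncoef_def coeff_scaled_def brace_sum_def)

lemma brace_sum_expand: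
  "brace_sum i n = (\<Sum>p\<in>partitions n. const (ncoef p (Suc i) / pfact p) * xpart p)"
  by (subst graded_expand[OF graded_brace_sum], intro sum.cong refl)
    (simp add: ncoef_eq pfact_nonzero partitions_def)

lemma const_sum: "const (\<Sum>i\<in>A. f i) = (\<Sum>i\<in>A. const (f i))"
  by (induction A rule: infinite_finite_induct) (simp_all add: const_add)

lemma log_term_eq:
  "log_term (Suc n) = (\<Sum>i=1..n. const ((-1) ^ i / of_nat (Suc i)) * brace_sum i n)"
proof -
  have "const ((\<Sum>i=2..sum_list p + 1. (-1) ^ (i - 1) / of_nat i * ncoef p i) / pfact p) * xpart p
      = (\<Sum>i=1..n. const ((-1) ^ i / of_nat (Suc i)) * (const (ncoef p (Suc i) / pfact p) * xpart p))"
    if "p \<in> partitions n" for p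
  proof -
    \<comment> \<open>The second index of \<open>ncoef\<close> exceeds the number of braces by one,
      while \<open>brace_sum\<close> is indexed by that number.\<close>
    have eq: "(\<Sum>i=2..sum_list p + 1. (-1) ^ (i - 1) / of_nat i * ncoef p i)
        = (\<Sum>i=1..n. (-1) ^ i / of_nat (Suc i) * ncoef p (Suc i))"
      using that sum.shift_bounds_cl_Suc_ivl[of "\<lambda>i. (-1) ^ (i - 1) / of_nat i * ncoef p i" 1 n]
      by (simp add: partitions_def numeral_2_eq_2)
    show ?thesis
      unfolding eq sum_divide_distrib const_sum sum_distrib_right
        mult.assoc[symmetric] const_mult[symmetric] times_divide_eq_right ..
  qed
  then have "log_term (Suc n) = (\<Sum>p\<in>partitions n. \<Sum>i=1..n. const ((-1) ^ i / of_nat (Suc i))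
      * (const (ncoef p (Suc i) / pfact p) * xpart p))"
    by (simp add: log_term_def)
  also have "\<dots> = (\<Sum>i=1..n. const ((-1) ^ i / of_nat (Suc i)) * brace_sum i n)"
    by (subst sum.swap) (simp only: brace_sum_expand sum_distrib_left)
  finally show ?thesis .
qed

lemma graded_log_term: "graded (Suc n) (-1) (log_term (Suc n))"
proof -
  have "graded (Suc n) (-1) (\<Sum>i=1..n. const ((-1) ^ i / of_nat (Suc i)) * brace_sum i n)"
    by (rule graded_sum, rule graded_const_mult, rule graded_brace_sum)
  then show ?thesis by (simp only: log_term_eq)
qed

text \<open>The term \<open>i = 0\<close> is the generator itself, which \<open>log_term\<close>
  omits; hence the separate case of degree 1.\<close>

lemma shift_log_embed_gen_nth:
  "fps_nth (shift_log (embed gen)) d = (if d = 0 then 0 else if d = 1 then gen else log_term d)"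
proof (cases d)
  case (Suc n)
  have "fps_nth (shift_log (embed gen)) (Suc n)
      = (\<Sum>i<Suc n. const ((-1) ^ i / of_nat (Suc i)) * brace_sum i n)"
    by (simp only: shift_log_def fps_nth_Abs_fps delta_funpow_embed_gen_nth)
  also have "\<dots> = brace_sum 0 n + (\<Sum>i=1..n. const ((-1) ^ i / of_nat (Suc i)) * brace_sum i n)"
  proof -
    have eq: "{..<Suc n} = insert 0 {1..n}" by auto
    show ?thesis unfolding eq by (subst sum.insert) simp_all
  qed
  also have "\<dots> = (if n = 0 then gen else log_term (Suc n))"
    unfolding log_term_eq brace_sum_0 by simp
  finally show ?thesis unfolding Suc by simp
qed (simp add: shift_log_def)

lemma graded_imp_Nov_homogeneous: "graded d (-1) f \<Longrightarrow> f \<in> Nov \<and> homogeneous d f"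
  by (simp add: graded_def Nov_def homogeneous_def)

lemma shift_log_embed_gen_Nov_compl: "shift_log (embed gen) \<in> Nov_compl"
proof -
  have "graded d (-1) (fps_nth (shift_log (embed gen)) d)" for d
  proof (cases d)
    case (Suc n)
    then show ?thesis
      using graded_gen graded_log_term[of n]
      by (cases "n = 0") (simp_all only: shift_log_embed_gen_nth One_nat_def nat.inject nat.distinct
          if_True if_False simp_thms)
  qed (simp add: shift_log_embed_gen_nth)
  then show ?thesis
    unfolding Nov_compl_def mem_Collect_eq using graded_imp_Nov_homogeneous by blast
qed

text \<open>\<open>inv_into\<close> returns the candidate because it lies in
  \<open>Nov_compl\<close>, is mapped to the generator, and the exponential is injective
  there.\<close>

lemma prelie_log_embed_gen: "prelie_log (embed gen) = shift_log (embed gen)"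
proof -
  have "inj_on prelie_exp Nov_compl"
    by (rule inj_onI) (rule prelie_exp_inj[OF Nov_compl_nth_0 Nov_compl_nth_0])
  moreover have "prelie_exp (shift_log (embed gen)) = embed gen"
    by (rule prelie_exp_shift_log) (simp add: embed_gen_nth)
  ultimately show ?thesis
    unfolding prelie_log_def using inv_into_f_f[OF _ shift_log_embed_gen_Nov_compl, of prelie_exp]
    by (simp only:)
qed

lemma log_terms_sums: "(\<lambda>n. embed (log_term (n + 2))) sums (shift_log (embed gen) - embed gen)"
  unfolding sums_def
proof (rule tendsto_fpsI)
  fix d
  have "fps_nth (\<Sum>n<N. embed (log_term (n + 2))) d = fps_nth (shift_log (embed gen) - embed gen) d"
    if "d \<le> N" for N
  proof -
    have "fps_nth (embed (log_term (n + 2))) d = (if d = n + 2 then log_term (n + 2) else 0)" for n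
      using embed_nth[OF graded_log_term[of "n + 1"]] by simp
    then have "fps_nth (\<Sum>n<N. embed (log_term (n + 2))) d
        = (\<Sum>n<N. if d = n + 2 then log_term (n + 2) else 0)"
      by (simp add: fps_sum_nth)
    also have "\<dots> = (\<Sum>n<N. if n = d - 2 then (if 2 \<le> d then log_term d else 0) else 0)"
      by (intro sum.cong refl) auto
    also have "\<dots> = (if 2 \<le> d then log_term d else 0)"
    proof -
      have "2 \<le> d \<Longrightarrow> d - 2 < N" using that by arith
      then show ?thesis by simp
    qed
    finally show ?thesis
      by (simp add: shift_log_embed_gen_nth embed_gen_nth)
  qed
  then show "\<forall>\<^sub>F N in sequentially. fps_nth (\<Sum>n<N. embed (log_term (n + 2))) d
      = fps_nth (shift_log (embed gen) - embed gen) d"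
    unfolding eventually_at_top_linorder by blast
qed

section \<open>Admissible chains\<close>

text \<open>Tail counts are the column heights of the Young diagram of \<open>p\<close>; for
  \<open>j \<ge> 1\<close> the padding by \<open>xv 0\<close> is not counted.\<close>

lemma tail_count:
  assumes "1 \<le> j"
  shows "msum (\<lambda>i. of_bool (j \<le> i)) (xpart_exp p) = int (length (filter (\<lambda>i. j \<le> i) p))"
proof -
  have "(\<Sum>i\<leftarrow>p. of_bool (j \<le> i)) = int (length (filter (\<lambda>i. j \<le> i) p))"
    by (induction p) simp_all
  then show ?thesis using assms by (simp add: msum_xpart_exp)
qed

text \<open>In a weakly decreasing list the entries \<ge> \<open>j\<close> form an initial segment.
  Together with \<open>length_filter_ge_nth\<close> this converts column heights into row
  lengths.\<close>

lemma length_filter_less_nth: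
  assumes "sorted_wrt (\<ge>) (p :: nat list)" "i < length p" "p ! i < j"
  shows "length (filter (\<lambda>x. j \<le> x) p) \<le> i"
proof -
  have "filter (\<lambda>x. j \<le> x) (drop i p) = []"
  proof -
    have "x \<le> p ! i" if x: "x \<in> set (drop i p)" for x
    proof -
      obtain k where k: "k < length (drop i p)" "x = drop i p ! k"
        using x by (metis in_set_conv_nth)
      then show ?thesis
        using assms(1,2) by (cases k) (auto simp: sorted_wrt_iff_nth_less)
    qed
    then show ?thesis using assms(3) by (fastforce simp: filter_empty_conv)
  qed
  moreover have "filter (\<lambda>x. j \<le> x) p = filter (\<lambda>x. j \<le> x) (take i p) @ filter (\<lambda>x. j \<le> x) (drop i p)"
    by (simp flip: filter_append)
  ultimately show ?thesis
    using length_filter_le[of "\<lambda>x. j \<le> x" "take i p"] by simp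
qed

lemma length_filter_ge_nth:
  assumes "sorted_wrt (\<ge>) (p :: nat list)" "i < length p"
  shows "i < length (filter (\<lambda>x. p ! i \<le> x) p)"
proof -
  have "\<forall>x\<in>set (take (Suc i) p). p ! i \<le> x"
    using assms by (auto simp: in_set_conv_nth sorted_wrt_iff_nth_less less_Suc_eq)
  then have "filter (\<lambda>x. p ! i \<le> x) (take (Suc i) p) = take (Suc i) p"
    by (rule filter_True)
  moreover have "filter (\<lambda>x. p ! i \<le> x) p
      = filter (\<lambda>x. p ! i \<le> x) (take (Suc i) p) @ filter (\<lambda>x. p ! i \<le> x) (drop (Suc i) p)"
    by (simp flip: filter_append)
  ultimately have "length (take (Suc i) p) \<le> length (filter (\<lambda>x. p ! i \<le> x) p)"
    by simp
  then show ?thesis using assms(2) by simp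
qed

text \<open>Multiplying by \<open>gen ^ k\<close> leaves the tail counts for
  \<open>j \<ge> 1\<close> unchanged and differentiation never lowers them, so the diagram of
  \<open>p'\<close> lies inside that of \<open>p\<close>.\<close>

lemma Ccoef_nonzero_imp_admissible:
  assumes p: "is_partition p" and p': "is_partition p'" and less: "sum_list p' < sum_list p"
    and nz: "Ccoef p p' \<noteq> 0"
  shows "admissible p' p"
proof -
  let ?k = "sum_list p - sum_list p'"
  let ?tail = "\<lambda>j. msum (\<lambda>i. of_bool (j \<le> i))"
  have "xpart_exp p \<in> Poly_Mapping.keys (gen ^ ?k * (der ^^ ?k) (xpart p'))"
    using nz by (auto simp: Ccoef_def Let_def coeff_scaled_def lookup_const_mult brace_gen in_keys_iff)
  then obtain a b where ab: "xpart_exp p = a + b" "a \<in> Poly_Mapping.keys (gen ^ ?k)"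
    "b \<in> Poly_Mapping.keys ((der ^^ ?k) (xpart p'))"
    using keys_mult by blast
  have "gen ^ k = xmonom (Poly_Mapping.single 0 k)" for k
  proof (induction k)
    case (Suc k)
    have "Poly_Mapping.single 0 (Suc k) = Poly_Mapping.single 0 1 + Poly_Mapping.single (0::nat) k"
      by (simp flip: single_add)
    then show ?case using Suc by (simp add: xmonom_add xv_def)
  qed (simp add: xmonom_def)
  then have a: "a = Poly_Mapping.single 0 ?k" using ab(2) by (simp add: xmonom_def)
  have keys: "Poly_Mapping.keys (xpart p') = {xpart_exp p'}"
    by (simp add: xpart_eq_monom xmonom_def)
  have tail: "?tail j (xpart_exp p) = ?tail j b" if "1 \<le> j" for j
    using that by (simp add: ab(1) a msum_add msum_single)
  have mono: "?tail j (xpart_exp p') \<le> ?tail j b" for j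
    using msum_keys_der_funpow[OF ab(3), of "\<lambda>x. 0 \<le> x" "\<lambda>i. of_bool (j \<le> i)"] keys by auto
  have deg: "msum (\<lambda>_. 1) b = msum (\<lambda>_. 1) (xpart_exp p')"
    using msum_keys_der_funpow[OF ab(3), of "\<lambda>x. x = 0" "\<lambda>_. 1"] keys by auto
  have cnt: "length (filter (\<lambda>i. j \<le> i) p') \<le> length (filter (\<lambda>i. j \<le> i) p)" if "1 \<le> j" for j
    using mono[of j] tail[OF that] tail_count[OF that] by simp
  have pos: "filter (\<lambda>i. 1 \<le> i) q = q" if "is_partition q" for q
    using that by (simp add: is_partition_def)
  have len: "length p' \<le> length p"
    using cnt[of 1] pos[OF p] pos[OF p'] by simp
  \<comment> \<open>Containment by columns gives containment by rows, tested at the column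
    \<open>j = p' ! i\<close>.\<close>
  have le: "p' ! i \<le> p ! i" if i: "i < length p'" for i
  proof (rule ccontr)
    assume "\<not> p' ! i \<le> p ! i"
    then have "length (filter (\<lambda>x. p' ! i \<le> x) p) \<le> i"
      using p i len by (intro length_filter_less_nth) (auto simp: is_partition_def)
    moreover have "i < length (filter (\<lambda>x. p' ! i \<le> x) p')"
      using p' i by (intro length_filter_ge_nth) (auto simp: is_partition_def)
    moreover have "1 \<le> p' ! i" using p' i by (simp add: is_partition_def)
    ultimately show False using cnt[of "p' ! i"] by simp
  qed
  have "length p < length p'" "False" if "length p' = length p" "\<forall>i<length p'. p' ! i = p ! i"
    using nth_equalityI[OF that(1)] that(2) less by auto
  then have strict: "length p' < length p \<or> (\<exists>i<length p'. p' ! i < p ! i)"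
    using len le by (metis le_neq_implies_less)
  \<comment> \<open>The parts of \<open>p\<close> are the factors of \<open>b\<close> with positive
    index, and differentiation keeps the number of factors at
    \<open>sum_list p' + 1\<close>.\<close>
  have "msum (\<lambda>i. of_bool (1 \<le> i)) b \<le> msum (\<lambda>_. 1) b"
    unfolding msum_def by (intro sum_mono) simp
  then have "length p \<le> sum_list p' + 1"
    using tail[of 1] tail_count[of 1 p] pos[OF p] deg mdeg_xpart_exp[OF p']
    by (simp flip: mdeg_eq_msum)
  then show ?thesis using len le strict by (simp add: admissible_def part_less_def)
qed

text \<open>Strictness comes either from a larger entry or from the additional parts of
  \<open>q\<close>, which are positive.\<close>

lemma part_less_sum_list:
  assumes "part_less p q" "is_partition q"
  shows "sum_list p < sum_list q"
proof -
  let ?n = "length p"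
  have "length p \<le> length q" using assms(1) by (simp add: part_less_def)
  then have q: "sum_list q = (\<Sum>i<?n. q ! i) + sum_list (drop ?n q)"
    using sum_list_append[of "take ?n q" "drop ?n q"]
    by (simp add: sum_list_sum_nth[of "take ?n q"] atLeast0LessThan)
  have p: "sum_list p = (\<Sum>i<?n. p ! i)"
    by (simp add: sum_list_sum_nth atLeast0LessThan)
  have le: "(\<Sum>i<?n. p ! i) \<le> (\<Sum>i<?n. q ! i)"
    using assms(1) by (intro sum_mono) (simp add: part_less_def)
  show ?thesis
  proof (cases "?n < length q")
    case True
    then have "drop ?n q = q ! ?n # drop (Suc ?n) q" by (simp add: Cons_nth_drop_Suc)
    then have "q ! ?n \<in> set (drop ?n q)" by (metis list.set_intros(1))
    moreover have "1 \<le> q ! ?n" using True assms(2) by (simp add: is_partition_def)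
    ultimately have "0 < sum_list (drop ?n q)"
      using member_le_sum_list[of "q ! ?n" "drop ?n q"] by simp
    then show ?thesis using p q le by simp
  next
    case False
    then obtain i where "i < ?n" "p ! i < q ! i" using assms(1) by (auto simp: part_less_def)
    then have "(\<Sum>i<?n. p ! i) < (\<Sum>i<?n. q ! i)"
      using assms(1) by (intro sum_strict_mono_ex1) (auto simp: part_less_def)
    then show ?thesis using p q by simp
  qed
qed

section \<open>Recursion on the last brace\<close>

definition adm_below :: "nat list \<Rightarrow> nat list set" where
  "adm_below p = {q. is_partition q \<and> admissible q p}"

lemma adm_below_subset:
  assumes "is_partition p"
  shows "adm_below p \<subseteq> (\<Union>j\<in>{1..sum_list p}. partitions (sum_list p - j))"
proof
  fix q assume q: "q \<in> adm_below p"
  then have "sum_list q < sum_list p"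
    using assms part_less_sum_list by (auto simp: adm_below_def admissible_def)
  then show "q \<in> (\<Union>j\<in>{1..sum_list p}. partitions (sum_list p - j))"
    using q by (intro UN_I[of "sum_list p - sum_list q"]) (auto simp: adm_below_def partitions_def)
qed

lemma finite_adm_below: "is_partition p \<Longrightarrow> finite (adm_below p)"
  by (erule finite_subset[OF adm_below_subset]) (simp add: finite_partitions)

text \<open>The outermost brace, of size \<open>j\<close>, acts on a combination of the
  \<open>xpart q\<close> with \<open>sum_list q = sum_list p - j\<close>; its effect on each is
  \<open>Ccoef p q\<close>, and inadmissible \<open>q\<close> contribute zero.\<close>

lemma ncoef_Suc:
  assumes p: "is_partition p"
  shows "ncoef p (Suc (Suc k)) = (\<Sum>q\<in>adm_below p. ncoef q (Suc k) * Ccoef p q)"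
proof -
  let ?n = "sum_list p"
  \<comment> \<open>The \<open>fact j\<close> in the normalisation of \<open>Ccoef\<close> accounts
    for the \<open>1 / fact j\<close> of the brace.\<close>
  have C: "1 / fact j * (ncoef q (Suc k) / pfact q)
        * Poly_Mapping.lookup (gen ^ j * (der ^^ j) (xpart q)) (xpart_exp p) * pfact p
      = ncoef q (Suc k) * Ccoef p q" if "j \<in> {1..?n}" "q \<in> partitions (?n - j)" for j q
  proof -
    have "?n - sum_list q = j" using that by (auto simp: partitions_def)
    then have "Ccoef p q = 1 / pfact q
        * Poly_Mapping.lookup (gen ^ j * (der ^^ j) (xpart q)) (xpart_exp p) / (fact j / pfact p)"
      by (simp only: Ccoef_def Let_def coeff_scaled_def lookup_const_mult brace_gen)
    then show ?thesis by (simp add: mult.commute)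
  qed
  have "brace_sum (Suc k) ?n = (\<Sum>j=1..?n. \<Sum>q\<in>partitions (?n - j).
      const (1 / fact j * (ncoef q (Suc k) / pfact q)) * (gen ^ j * (der ^^ j) (xpart q)))"
    unfolding brace_sum_Suc
  proof (rule sum.cong[OF refl])
    fix j
    have eq: "a * (g * (b * x)) = (a * b) * (g * x)" for a b g x :: alg
      by (simp only: mult.assoc mult.left_commute[of g b])
    have "(der ^^ j) (brace_sum k (?n - j)) = (\<Sum>q\<in>partitions (?n - j).
        const (ncoef q (Suc k) / pfact q) * (der ^^ j) (xpart q))"
      by (simp only: brace_sum_expand der_funpow_sum der_funpow_const_mult)
    then show "const (1 / fact j) * (gen ^ j * (der ^^ j) (brace_sum k (?n - j)))
        = (\<Sum>q\<in>partitions (?n - j). const (1 / fact j * (ncoef q (Suc k) / pfact q))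
            * (gen ^ j * (der ^^ j) (xpart q)))"
      by (simp only: sum_distrib_left eq const_mult)
  qed
  then have "ncoef p (Suc (Suc k))
      = (\<Sum>j=1..?n. \<Sum>q\<in>partitions (?n - j). ncoef q (Suc k) * Ccoef p q)"
    by (simp only: ncoef_eq[of p] lookup_sum lookup_const_mult sum_distrib_right C cong: sum.cong)
  \<comment> \<open>The size of \<open>q\<close> determines \<open>j\<close>, so the union is
    disjoint.\<close>
  also have "\<dots> = (\<Sum>q\<in>(\<Union>j\<in>{1..?n}. partitions (?n - j)). ncoef q (Suc k) * Ccoef p q)"
    by (rule sum.UNION_disjoint[symmetric]) (auto simp: finite_partitions, auto simp: partitions_def)
  also have "\<dots> = (\<Sum>q\<in>adm_below p. ncoef q (Suc k) * Ccoef p q)"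
  proof (rule sum.mono_neutral_right)
    show "\<forall>q\<in>(\<Union>j\<in>{1..?n}. partitions (?n - j)) - adm_below p. ncoef q (Suc k) * Ccoef p q = 0"
    proof
      fix q assume "q \<in> (\<Union>j\<in>{1..?n}. partitions (?n - j)) - adm_below p"
      then have "is_partition q" "sum_list q < ?n" "\<not> admissible q p"
        by (auto simp: partitions_def adm_below_def)
      then show "ncoef q (Suc k) * Ccoef p q = 0"
        using Ccoef_nonzero_imp_admissible[OF p] by auto
    qed
  qed (use adm_below_subset[OF p] in \<open>simp_all add: finite_partitions\<close>)
  finally show ?thesis .
qed

section \<open>Unfolding the recursion into chains\<close>

lemma adm_chains_0: "adm_chains 0 p = (if p = [] then {[[]]} else {})"
proof -
  have "adm_chains 0 p = {ps. length ps = Suc 0 \<and> is_partition (ps ! 0) \<and> ps ! 0 = [] \<and> ps ! 0 = p}"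
    by (simp add: adm_chains_def)
  also have "\<dots> = (if p = [] then {[[]]} else {})"
    by (auto simp: length_Suc_conv is_partition_def)
  finally show ?thesis .
qed

lemma adm_chains_Suc:
  assumes "is_partition p"
  shows "adm_chains (Suc k) p = (\<Union>q\<in>adm_below p. (\<lambda>ps. ps @ [p]) ` adm_chains k q)"
proof (intro equalityI subsetI)
  fix ps assume ps: "ps \<in> adm_chains (Suc k) p"
  then have "ps \<noteq> []" by (auto simp: adm_chains_def)
  then obtain qs r where qs: "ps = qs @ [r]" by (metis rev_exhaust)
  have len: "length qs = Suc k" using ps qs by (simp add: adm_chains_def)
  have r: "r = p" using ps len by (simp add: adm_chains_def qs nth_append)
  have "is_partition (qs ! h)" if "h \<le> k" for h
  proof -
    have "is_partition (ps ! h)" using ps that by (simp add: adm_chains_def)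
    then show ?thesis using that len by (simp add: qs nth_append)
  qed
  moreover have "admissible (qs ! (h - 1)) (qs ! h)" if "h \<in> {1..k}" for h
  proof -
    have "admissible (ps ! (h - 1)) (ps ! h)" using ps that by (simp add: adm_chains_def)
    moreover have "h - 1 < length qs" "h < length qs" using that len by auto
    ultimately show ?thesis by (simp only: qs nth_append if_True)
  qed
  moreover have "qs ! 0 = []" using ps len by (simp add: adm_chains_def qs nth_append)
  moreover have "admissible (qs ! k) p"
  proof -
    have "admissible (ps ! (Suc k - 1)) (ps ! Suc k)"
      using ps unfolding adm_chains_def by fastforce
    then show ?thesis using len r by (simp add: qs nth_append)
  qed
  ultimately have "qs \<in> adm_chains k (qs ! k)" "qs ! k \<in> adm_below p"
    using len by (simp_all add: adm_chains_def adm_below_def)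
  then show "ps \<in> (\<Union>q\<in>adm_below p. (\<lambda>ps. ps @ [p]) ` adm_chains k q)"
    unfolding qs r by blast
next
  fix ps assume "ps \<in> (\<Union>q\<in>adm_below p. (\<lambda>ps. ps @ [p]) ` adm_chains k q)"
  then obtain q qs where q: "q \<in> adm_below p" "qs \<in> adm_chains k q" "ps = qs @ [p]" by blast
  then have len: "length qs = Suc k" by (simp add: adm_chains_def)
  have "is_partition (ps ! h)" if "h \<le> Suc k" for h
    using that q len assms by (cases "h = Suc k") (auto simp: adm_chains_def nth_append)
  moreover have "admissible (ps ! (h - 1)) (ps ! h)" if "h \<in> {1..Suc k}" for h
  proof (cases "h = Suc k")
    case True
    then show ?thesis using q len by (simp add: adm_chains_def adm_below_def nth_append)
  next
    case False
    then have h: "h \<in> {1..k}" using that by auto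
    then have "admissible (qs ! (h - 1)) (qs ! h)" using q(2) by (simp add: adm_chains_def)
    moreover have "h - 1 < length qs" "h < length qs" using h len by auto
    ultimately show ?thesis by (simp only: q(3) nth_append if_True)
  qed
  ultimately show "ps \<in> adm_chains (Suc k) p"
    using q len by (simp add: adm_chains_def nth_append)
qed

lemma finite_adm_chains: "is_partition p \<Longrightarrow> finite (adm_chains k p)"
proof (induction k arbitrary: p)
  case (Suc k)
  have "finite (adm_chains k q)" if "q \<in> adm_below p" for q
    using that Suc.IH by (simp add: adm_below_def)
  then show ?case
    using finite_adm_below Suc.prems by (auto simp: adm_chains_Suc)
qed (simp add: adm_chains_0)

text \<open>Base of the recursion, with no brace at all: only the empty composition can contribute,
  and it yields the generator.\<close>

lemma ncoef_1: "is_partition p \<Longrightarrow> ncoef p (Suc 0) = (if p = [] then 1 else 0)"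
proof (cases p)
  case Nil
  have "xpart_exp [] = Poly_Mapping.single 0 1" by (simp add: xpart_exp_def)
  then show ?thesis
    using Nil by (simp add: ncoef_eq brace_sum_0 xv_def xmonom_def pfact_def)
next
  case (Cons i q)
  moreover assume "is_partition p"
  ultimately have "sum_list p \<noteq> 0" by (simp add: is_partition_def)
  then show ?thesis using Cons by (simp only: ncoef_eq brace_sum_0) simp
qed

text \<open>The induction starts at \<open>k = 0\<close>, where only the chain \<open>[[]]\<close>
  exists; each step appends \<open>p\<close> to a chain ending in \<open>q\<close> and multiplies
  its weight by \<open>Ccoef p q\<close>.\<close>

lemma ncoef_eq_sum_adm_chains:
  "is_partition p \<Longrightarrow>
    ncoef p (Suc k) = (\<Sum>ps\<in>adm_chains k p. \<Prod>h=1..k. Ccoef (ps ! h) (ps ! (h - 1)))"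
proof (induction k arbitrary: p)
  case 0
  then show ?case by (simp add: ncoef_1 adm_chains_0)
next
  case (Suc k)
  let ?w = "\<lambda>k ps. \<Prod>h=1..k. Ccoef (ps ! h) (ps ! (h - 1))"
  have w: "?w (Suc k) (qs @ [p]) = ?w k qs * Ccoef p q" if "qs \<in> adm_chains k q" for q qs
  proof -
    have len: "length qs = Suc k" and last: "qs ! k = q" using that by (simp_all add: adm_chains_def)
    have "?w k (qs @ [p]) = ?w k qs"
    proof (rule prod.cong[OF refl])
      fix h assume "h \<in> {1..k}"
      then have "h < length qs" "h - 1 < length qs" using len by auto
      then show "Ccoef ((qs @ [p]) ! h) ((qs @ [p]) ! (h - 1)) = Ccoef (qs ! h) (qs ! (h - 1))"
        by (simp only: nth_append if_True)
    qed
    moreover have "?w (Suc k) (qs @ [p])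
        = ?w k (qs @ [p]) * Ccoef ((qs @ [p]) ! Suc k) ((qs @ [p]) ! k)"
      by (simp add: prod.cl_ivl_Suc)
    ultimately show ?thesis using len last by (simp add: nth_append)
  qed
  have part: "is_partition q" if "q \<in> adm_below p" for q
    using that by (simp add: adm_below_def)
  have "(\<Sum>ps\<in>adm_chains (Suc k) p. ?w (Suc k) ps)
      = (\<Sum>q\<in>adm_below p. \<Sum>ps\<in>(\<lambda>ps. ps @ [p]) ` adm_chains k q. ?w (Suc k) ps)"
    unfolding adm_chains_Suc[OF Suc.prems]
  proof (rule sum.UNION_disjoint)
    show "\<forall>q\<in>adm_below p. \<forall>r\<in>adm_below p. q \<noteq> r \<longrightarrow>
        (\<lambda>ps. ps @ [p]) ` adm_chains k q \<inter> (\<lambda>ps. ps @ [p]) ` adm_chains k r = {}"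
      by (auto simp: adm_chains_def)
  qed (auto simp: finite_adm_below finite_adm_chains Suc.prems part)
  also have "\<dots> = (\<Sum>q\<in>adm_below p. \<Sum>qs\<in>adm_chains k q. ?w k qs * Ccoef p q)"
  proof (rule sum.cong[OF refl])
    fix q
    have "inj_on (\<lambda>ps. ps @ [p]) (adm_chains k q)" by (simp add: inj_on_def)
    then have "(\<Sum>ps\<in>(\<lambda>ps. ps @ [p]) ` adm_chains k q. ?w (Suc k) ps)
        = (\<Sum>qs\<in>adm_chains k q. ?w (Suc k) (qs @ [p]))"
      by (simp only: sum.reindex comp_def)
    also have "\<dots> = (\<Sum>qs\<in>adm_chains k q. ?w k qs * Ccoef p q)"
      by (rule sum.cong[OF refl]) (rule w)
    finally show "(\<Sum>ps\<in>(\<lambda>ps. ps @ [p]) ` adm_chains k q. ?w (Suc k) ps)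
        = (\<Sum>qs\<in>adm_chains k q. ?w k qs * Ccoef p q)" .
  qed
  also have "\<dots> = (\<Sum>q\<in>adm_below p. ncoef q (Suc k) * Ccoef p q)"
    by (rule sum.cong[OF refl]) (simp only: Suc.IH[OF part] sum_distrib_right)
  also have "\<dots> = ncoef p (Suc (Suc k))"
    by (rule ncoef_Suc[OF Suc.prems, symmetric])
  finally show ?case ..
qed

theorem theorem8p5:
  shows "summable (\<lambda>n. embed (log_term (n + 2))) \<and>
         prelie_log (embed gen) = embed gen + suminf (\<lambda>n. embed (log_term (n + 2))) \<and>
         (\<forall>p k. is_partition p \<and> p \<noteq> [] \<and> 1 \<le> k \<longrightarrow>
            ncoef p (k + 1) =
              (\<Sum>ps\<in>adm_chains k p. \<Prod>h=1..k. Ccoef (ps ! h) (ps ! (h - 1))))"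
proof (intro conjI allI impI)
  show "summable (\<lambda>n. embed (log_term (n + 2)))"
    by (rule sums_summable[OF log_terms_sums])
  show "prelie_log (embed gen) = embed gen + suminf (\<lambda>n. embed (log_term (n + 2)))"
    unfolding sums_unique[OF log_terms_sums, symmetric] prelie_log_embed_gen by simp
  fix p :: "nat list" and k :: nat
  assume "is_partition p \<and> p \<noteq> [] \<and> 1 \<le> k"
  then show "ncoef p (k + 1) =
      (\<Sum>ps\<in>adm_chains k p. \<Prod>h=1..k. Ccoef (ps ! h) (ps ! (h - 1)))"
    using ncoef_eq_sum_adm_chains[of p k] by simp
qed

end
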